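(* Given two Wheeler automata $\mathcal{A}_0=(V_0,E_0,F_0,s_0,\Sigma)$ and $\mathcal{A}_1=(V_1,E_1,F_1,s_1,\Sigma)$, each with its Wheeler ordering, in $\mathcal{O}(|E_0|\,|E_1|)$ time one can find a Wheeler C-order for their union automaton or report that no such order exists.
   Context: A directed edge-labeled graph is a Wheeler graph if there is an ordering of its nodes such that nodes with in-degree $0$ precede those with positive in-degree and, for any edges $(u,v)$ labeled $a$ and $(u',v')$ labeled $a'$: $a<a'\Rightarrow v<v'$, and $(a=a')\wedge(u<u')\Rightarrow v\le v'$. An NFA $(V,E,F,s,\Sigma)$ has states $V$, labeled edges $E\subseteq V\times V\times\Sigma$, final states $F$, start state $s$; $s$ is the only state of in-degree $0$, every state is reachable from $s$ and can reach a final state. A Wheeler automaton is an NFA without $\epsilon$-transitions together with an ordering of its states making its state diagram a Wheeler graph. Union automaton $\mathcal{U}=(V,E,F,s,\Sigma)$ (with $V_0,V_1$ disjoint): $V=(V_0\setminus\{s_0\})\cup(V_1\setminus\{s_1\})\cup\{s\}$; $E=E_0^*\cup E_1^*$ where $E_i^*$ is $E_i$ with every edge leaving $s_i$ replaced by an edge leaving $s$ with the same destination and label; $F=(F_0\setminus\{s_0\})\cup(F_1\setminus\{s_1\})$, plus $s$ if $s_0\in F_0$ or $s_1\in F_1$. A Wheeler C-order for $\mathcal{U}$ is an ordering of $V$ making $\mathcal{U}$ a Wheeler graph and such that for $u,v\in V_0\setminus\{s_0\}$ (resp. $V_1\setminus\{s_1\}$) we have $u<v$ in $V$ iff $u<v$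 in the given ordering of $V_0$ (resp. $V_1$). *)

theory Defs
  imports Main
begin

section \<open>Wheeler graphs and Wheeler automata\<close>

text \<open>Edges are triples (source, target, label). An ordering of a node set \<open>V\<close> is a strict linear
  order \<open>r \<subseteq> V \<times> V\<close>, with \<open>(u, v) \<in> r\<close> meaning \<open>u < v\<close>.\<close>

definition in_degree :: "('v \<times> 'v \<times> 'a) set \<Rightarrow> 'v \<Rightarrow> nat" where
  "in_degree E v = card {e \<in> E. fst (snd e) = v}"

definition ordering_on :: "'v set \<Rightarrow> 'v rel \<Rightarrow> bool" where
  "ordering_on V r \<longleftrightarrow> r \<subseteq> V \<times> V \<and> strict_linear_order_on V r"

definition wheeler_order :: "'v set \<Rightarrow> ('v \<times> 'v \<times> 'a::linorder) set \<Rightarrow> 'v rel \<Rightarrow> bool" where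
  "wheeler_order V E r \<longleftrightarrow>
     ordering_on V r \<and>
     (\<forall>u\<in>V. \<forall>v\<in>V. in_degree E u = 0 \<and> in_degree E v > 0 \<longrightarrow> (u, v) \<in> r) \<and>
     (\<forall>(u, v, a)\<in>E. \<forall>(u', v', a')\<in>E.
        (a < a' \<longrightarrow> (v, v') \<in> r) \<and>
        (a = a' \<and> (u, u') \<in> r \<longrightarrow> v = v' \<or> (v, v') \<in> r))"

record ('v, 'a) nfa =
  states :: "'v set"
  edges :: "('v \<times> 'v \<times> 'a) set"
  finals :: "'v set"
  start :: 'v
  alphabet :: "'a set"

definition steps :: "('v, 'a) nfa \<Rightarrow> 'v rel" where
  "steps A = {(u, v). \<exists>a. (u, v, a) \<in> edges A}"

definition is_nfa :: "('v, 'a) nfa \<Rightarrow> bool" where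
  "is_nfa A \<longleftrightarrow>
     finite (states A) \<and> finite (alphabet A) \<and>
     edges A \<subseteq> states A \<times> states A \<times> alphabet A \<and>
     finals A \<subseteq> states A \<and> start A \<in> states A \<and>
     (\<forall>v\<in>states A. in_degree (edges A) v = 0 \<longleftrightarrow> v = start A) \<and>
     (\<forall>v\<in>states A. (start A, v) \<in> (steps A)\<^sup>* \<and> (\<exists>f\<in>finals A. (v, f) \<in> (steps A)\<^sup>*))"

definition wheeler_automaton :: "('v, 'a::linorder) nfa \<Rightarrow> 'v rel \<Rightarrow> bool" where
  "wheeler_automaton A r \<longleftrightarrow> is_nfa A \<and> wheeler_order (states A) (edges A) r"


section \<open>Union automata and C-orders\<close>

definition redirect :: "'v \<Rightarrow> 'v \<Rightarrow> ('v \<times> 'v \<times> 'a) set \<Rightarrow> ('v \<times> 'v \<times> 'a) set" where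
  "redirect s0 s E = (\<lambda>(u, v, a). (if u = s0 then s else u, v, a)) ` E"

text \<open>Meant for automata with disjoint state sets and a common alphabet, and a new state \<open>s\<close>.\<close>

definition union_nfa :: "'v \<Rightarrow> ('v, 'a) nfa \<Rightarrow> ('v, 'a) nfa \<Rightarrow> ('v, 'a) nfa" where
  "union_nfa s A0 A1 =
     \<lparr>states = (states A0 - {start A0}) \<union> (states A1 - {start A1}) \<union> {s},
      edges = redirect (start A0) s (edges A0) \<union> redirect (start A1) s (edges A1),
      finals = (finals A0 - {start A0}) \<union> (finals A1 - {start A1}) \<union>
        (if start A0 \<in> finals A0 \<or> start A1 \<in> finals A1 then {s} else {}),
      start = s,
      alphabet = alphabet A0\<rparr>"

definition wheeler_C_order ::
  "'v \<Rightarrow> ('v, 'a::linorder) nfa \<Rightarrow> 'v rel \<Rightarrow> ('v, 'a) nfa \<Rightarrow> 'v rel \<Rightarrow> 'v rel \<Rightarrow> bool" where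
  "wheeler_C_order s A0 r0 A1 r1 r \<longleftrightarrow>
     wheeler_order (states (union_nfa s A0 A1)) (edges (union_nfa s A0 A1)) r \<and>
     (\<forall>u\<in>states A0 - {start A0}. \<forall>v\<in>states A0 - {start A0}. (u, v) \<in> r \<longleftrightarrow> (u, v) \<in> r0) \<and>
     (\<forall>u\<in>states A1 - {start A1}. \<forall>v\<in>states A1 - {start A1}. (u, v) \<in> r \<longleftrightarrow> (u, v) \<in> r1)"


section \<open>Random access machines under the uniform cost criterion\<close>

text \<open>
  Running time is measured on a random access machine with structured control flow. It has
  number registers and arrays; registers and arrays are named by constants of the program, whereas
  array cells are addressed indirectly. A program mentions only finitely many arrays, so they can be
  interleaved in a single memory at the cost of a constant factor. As usual for the
  uniform cost criterion, the only arithmetic is addition and (truncated) subtraction: there is no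
  unit-cost multiplication and no bit operation.
\<close>

datatype exp =
    Const nat
  | Reg nat
  | Cell nat exp
  | Plus exp exp
  | Minus exp exp

datatype cond = Less exp exp | Equal exp exp

datatype prog =
    Skip
  | Assign nat exp
  | Store nat exp exp
  | Seq prog prog
  | If cond prog prog
  | While cond prog

record config =
  regs :: "nat \<Rightarrow> nat"
  arrays :: "nat \<Rightarrow> nat \<Rightarrow> nat"

fun eval :: "exp \<Rightarrow> config \<Rightarrow> nat" where
  "eval (Const n) \<sigma> = n"
| "eval (Reg x) \<sigma> = regs \<sigma> x"
| "eval (Cell k e) \<sigma> = arrays \<sigma> k (eval e \<sigma>)"
| "eval (Plus e f) \<sigma> = eval e \<sigma> + eval f \<sigma>"
| "eval (Minus e f) \<sigma> = eval e \<sigma> - eval f \<sigma>"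

fun holds :: "cond \<Rightarrow> config \<Rightarrow> bool" where
  "holds (Less e f) \<sigma> \<longleftrightarrow> eval e \<sigma> < eval f \<sigma>"
| "holds (Equal e f) \<sigma> \<longleftrightarrow> eval e \<sigma> = eval f \<sigma>"

fun exp_cost :: "exp \<Rightarrow> nat" where
  "exp_cost (Const n) = 1"
| "exp_cost (Reg x) = 1"
| "exp_cost (Cell k e) = 1 + exp_cost e"
| "exp_cost (Plus e f) = 1 + exp_cost e + exp_cost f"
| "exp_cost (Minus e f) = 1 + exp_cost e + exp_cost f"

fun cond_cost :: "cond \<Rightarrow> nat" where
  "cond_cost (Less e f) = 1 + exp_cost e + exp_cost f"
| "cond_cost (Equal e f) = 1 + exp_cost e + exp_cost f"

text \<open>\<open>run p \<sigma> t \<tau>\<close>: started in \<open>\<sigma>\<close>, program \<open>p\<close> halts in \<open>\<tau>\<close> after exactly \<open>t\<close> time units.\<close>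

inductive run :: "prog \<Rightarrow> config \<Rightarrow> nat \<Rightarrow> config \<Rightarrow> bool" where
  Skip: "run Skip \<sigma> 1 \<sigma>"
| Assign: "run (Assign x e) \<sigma> (1 + exp_cost e) (\<sigma>\<lparr>regs := (regs \<sigma>)(x := eval e \<sigma>)\<rparr>)"
| Store: "run (Store k e f) \<sigma> (1 + exp_cost e + exp_cost f)
    (\<sigma>\<lparr>arrays := (arrays \<sigma>)(k := (arrays \<sigma> k)(eval e \<sigma> := eval f \<sigma>))\<rparr>)"
| Seq: "run p \<sigma> t \<tau> \<Longrightarrow> run q \<tau> t' \<rho> \<Longrightarrow> run (Seq p q) \<sigma> (t + t') \<rho>"
| IfTrue: "holds b \<sigma> \<Longrightarrow> run p \<sigma> t \<tau> \<Longrightarrow> run (If b p q) \<sigma> (1 + cond_cost b + t) \<tau>"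
| IfFalse: "\<not> holds b \<sigma> \<Longrightarrow> run q \<sigma> t \<tau> \<Longrightarrow> run (If b p q) \<sigma> (1 + cond_cost b + t) \<tau>"
| WhileTrue: "holds b \<sigma> \<Longrightarrow> run p \<sigma> t \<tau> \<Longrightarrow> run (While b p) \<tau> t' \<rho> \<Longrightarrow>
    run (While b p) \<sigma> (1 + cond_cost b + t + t') \<rho>"
| WhileFalse: "\<not> holds b \<sigma> \<Longrightarrow> run (While b p) \<sigma> (1 + cond_cost b) \<sigma>"

inductive_cases SkipE: "run Skip \<sigma> t \<tau>"
inductive_cases AssignE: "run (Assign x e) \<sigma> t \<tau>"
inductive_cases StoreE: "run (Store k e f) \<sigma> t \<tau>"
inductive_cases SeqE: "run (Seq p q) \<sigma> t \<tau>"
inductive_cases IfE: "run (If b p q) \<sigma> t \<tau>"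
inductive_cases WhileE: "run (While b p) \<sigma> t \<tau>"

lemma run_deterministic: "run p \<sigma> t \<tau> \<Longrightarrow> run p \<sigma> t' \<tau>' \<Longrightarrow> t' = t \<and> \<tau>' = \<tau>"
proof (induction arbitrary: t' \<tau>' rule: run.induct)
  case (Skip \<sigma>)
  then show ?case by (auto elim: SkipE)
next
  case (Assign x e \<sigma>)
  then show ?case by (auto elim: AssignE)
next
  case (Store k e f \<sigma>)
  then show ?case by (auto elim: StoreE)
next
  case (Seq p \<sigma> t \<tau> q t2 \<rho>)
  from Seq.prems show ?case by (rule SeqE) (auto dest: Seq.IH)
next
  case (IfTrue b \<sigma> p t \<tau> q)
  from IfTrue.prems show ?case by (rule IfE) (use IfTrue.hyps in \<open>auto dest: IfTrue.IH\<close>)+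
next
  case (IfFalse b \<sigma> q t \<tau> p)
  from IfFalse.prems show ?case by (rule IfE) (use IfFalse.hyps in \<open>auto dest: IfFalse.IH\<close>)+
next
  case (WhileTrue b \<sigma> p t \<tau> t2 \<rho>)
  from WhileTrue.prems show ?case by (rule WhileE) (use WhileTrue.hyps in \<open>auto dest: WhileTrue.IH\<close>)+
next
  case (WhileFalse b \<sigma> p)
  from WhileFalse.prems show ?case by (rule WhileE) (use WhileFalse.hyps in auto)+
qed


section \<open>Input and output\<close>

definition list_order :: "'v list \<Rightarrow> 'v rel" where
  "list_order xs = {(xs ! i, xs ! j) | i j. i < j \<and> j < length xs}"

text \<open>The states are listed in their given order; the edges and the final states are listed in any
  order. State names and labels are arbitrary natural numbers; the order of the alphabet is the
  order of the natural numbers.\<close>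

definition listing ::
  "('v, 'a) nfa \<Rightarrow> 'v list \<Rightarrow> ('v \<times> 'v \<times> 'a) list \<Rightarrow> 'v list \<Rightarrow> bool" where
  "listing A vs es fs \<longleftrightarrow>
     distinct vs \<and> set vs = states A \<and> distinct es \<and> set es = edges A \<and>
     distinct fs \<and> set fs = finals A"

definition reg_input :: "nat list \<Rightarrow> (nat \<times> nat \<times> nat) list \<Rightarrow> nat list \<Rightarrow> nat \<Rightarrow> nat list" where
  "reg_input vs es fs s = [length vs, length es, length fs, s]"

definition array_input :: "nat list \<Rightarrow> (nat \<times> nat \<times> nat) list \<Rightarrow> nat list \<Rightarrow> nat list list" where
  "array_input vs es fs =
     [vs, map fst es, map (fst \<circ> snd) es, map (snd \<circ> snd) es, fs]"

definition contents :: "nat list \<Rightarrow> nat \<Rightarrow> nat" where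
  "contents xs i = (if i < length xs then xs ! i else 0)"

definition initial :: "nat list \<Rightarrow> nat list list \<Rightarrow> config" where
  "initial rs xss =
     \<lparr>regs = contents rs, arrays = (\<lambda>k. if k < length xss then contents (xss ! k) else (\<lambda>_. 0))\<rparr>"

text \<open>A zero in register 0 reports failure. Otherwise the result is the list of the length
  stored in register 1 that is stored in array 0.\<close>

definition result :: "config \<Rightarrow> nat list option" where
  "result \<sigma> = (if regs \<sigma> 0 = 0 then None else Some (map (arrays \<sigma> 0) [0..<regs \<sigma> 1]))"

end

theory Submission
  imports Defs
begin

text \<open>
  A C-order merges the two given orders, so it is determined by the truth values of the statements
  \<open>us ! i < vs ! j\<close>, where \<open>us\<close> and \<open>vs\<close> list the states; these are monotone in \<open>i\<close> and \<open>j\<close>. A pair of edges, one from each automaton,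
  makes the statement about its targets true or false if the labels differ, and equivalent to
  the statement about its sources if the labels agree. Hence all conditions are implications between
  single statements. They are satisfiable iff no false statement is reachable from a
  true one; in that case the set of reachable statements is the least solution and defines a merge.
  There are at most \<open>|V\<^sub>0| |V\<^sub>1|\<close> statements and \<open>2 |V\<^sub>0| |V\<^sub>1| + 2 |E\<^sub>0| |E\<^sub>1|\<close>
  implications, and \<open>|V\<^sub>i| \<le> |E\<^sub>i| + 1\<close>, since every state but the start state has an incoming edge.
\<close>


section \<open>Indexed Wheeler automata\<close>

text \<open>Two features keep the problem below general satisfiability. First, a merge of two chains
  is the same as a monotone table of comparisons: transitivity across the chains amounts to single
  steps along a row or a column, so no clause has to mention three states. Second, the Wheeler
  condition on two edges with equal labels is one-directional as written, but becomes an equivalence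
  across the automata: the targets are distinct, so \<open>v \<le> v'\<close> is strict, and if
  \<open>u < u'\<close> fails for distinct sources, then \<open>u' < u\<close> by totality, which
  forces \<open>v' < v\<close>. Every clause thus has one premise and one conclusion, unit clauses
  being attached to one true and one false node, so that plain graph search decides. Pairs of edges
  of the same automaton add nothing, because a C-order restricts to the given orders and the common
  start state comes first.

  On the machine, a table cell must be addressed from two states without multiplication. State names
  are arbitrary, but they may serve as addresses, so a stored row offset for each state reduces this
  to one addition.\<close>

lemma list_order_nth_iff:
  assumes "distinct xs" "i < length xs" "j < length xs"
  shows "(xs ! i, xs ! j) \<in> list_order xs \<longleftrightarrow> i < j"
  using assms by (auto simp: list_order_def nth_eq_iff_index_eq)

lemma ordering_on_list_order:
  assumes "distinct xs"
  shows "ordering_on (set xs) (list_order xs)"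
proof -
  have "trans (list_order xs)"
    using assms by (auto simp: trans_def list_order_def nth_eq_iff_index_eq) (use less_trans in blast)
  moreover have "irrefl (list_order xs)"
    using assms by (auto simp: irrefl_def list_order_def nth_eq_iff_index_eq)
  moreover have "total_on (set xs) (list_order xs)"
    by (auto simp: total_on_def list_order_def in_set_conv_nth) (metis nat_neq_iff)
  ultimately show ?thesis
    by (auto simp: ordering_on_def strict_linear_order_on_def list_order_def)
qed

lemma in_degree_pos_iff:
  assumes "finite E"
  shows "in_degree E v > 0 \<longleftrightarrow> (\<exists>u a. (u, v, a) \<in> E)"
  using assms by (auto simp: in_degree_def card_gt_0_iff)

text \<open>A Wheeler automaton seen through positions: index 0 is the start state, so exactly the
  positive indices are targets of edges. The bounds on \<open>k\<close> and \<open>k'\<close> keep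
  \<open>nth\<close> inside the list, where distinctness makes positions and states
  interchangeable.\<close>

locale indexed_wheeler =
  fixes xs :: "'v list" and E :: "('v \<times> 'v \<times> 'a::linorder) set"
  assumes distinct: "distinct xs"
    and finite_edges: "finite E"
    and nonempty: "0 < length xs"
    and edge_nth: "(u, v, a) \<in> E \<Longrightarrow>
      \<exists>i k. i < length xs \<and> 0 < k \<and> k < length xs \<and> u = xs ! i \<and> v = xs ! k"
    and in_edge: "0 < k \<Longrightarrow> k < length xs \<Longrightarrow> \<exists>u a. (u, xs ! k, a) \<in> E"
    and label_mono: "(xs ! i, xs ! k, a) \<in> E \<Longrightarrow> (xs ! i', xs ! k', b) \<in> E \<Longrightarrow>
      k < length xs \<Longrightarrow> k' < length xs \<Longrightarrow> a < b \<Longrightarrow> k < k'"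
    and source_mono: "(xs ! i, xs ! k, a) \<in> E \<Longrightarrow> (xs ! i', xs ! k', a) \<in> E \<Longrightarrow>
      i < i' \<Longrightarrow> i' < length xs \<Longrightarrow> k < length xs \<Longrightarrow> k' < length xs \<Longrightarrow> k \<le> k'"
begin

lemma length_le: "length xs \<le> Suc (card E)"
proof -
  have "(!) xs ` {1..<length xs} \<subseteq> (fst \<circ> snd) ` E"
  proof
    fix v assume "v \<in> (!) xs ` {1..<length xs}"
    then obtain k where "k \<in> {1..<length xs}" and v: "v = xs ! k" by blast
    then have k: "0 < k" "k < length xs" by simp_all
    from in_edge[OF k(1,2)] obtain u a where "(u, xs ! k, a) \<in> E" by blast
    then show "v \<in> (fst \<circ> snd) ` E" using v by (intro image_eqI[of _ _ "(u, xs ! k, a)"]) simp_all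
  qed
  then have "card ((!) xs ` {1..<length xs}) \<le> card E"
    using finite_edges by (meson card_image_le card_mono finite_imageI le_trans)
  moreover have "card ((!) xs ` {1..<length xs}) = length xs - 1"
    using distinct by (subst card_image) (auto simp: inj_on_def nth_eq_iff_index_eq)
  ultimately show ?thesis by simp
qed

lemma first_notin_tl: "0 < k \<Longrightarrow> k < length xs \<Longrightarrow> xs ! k \<noteq> xs ! 0"
  using distinct nonempty by (auto simp: nth_eq_iff_index_eq)

lemma set_minus_first: "set xs - {xs ! 0} = {xs ! k | k. 0 < k \<and> k < length xs}"
  using distinct nonempty by (auto simp: in_set_conv_nth nth_eq_iff_index_eq) (metis gr0I)

end

text \<open>Any other state in front would have positive in-degree, so the start state would have to
  precede it.\<close>

lemma wheeler_automaton_start: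
  assumes "wheeler_automaton A (list_order xs)" "listing A xs es fs"
  shows "0 < length xs" "xs ! 0 = start A"
proof -
  have V: "set xs = states A" "distinct xs" and s: "start A \<in> states A"
    and d: "\<And>v. v \<in> states A \<Longrightarrow> in_degree (edges A) v = 0 \<longleftrightarrow> v = start A"
    and o: "\<And>u v. u \<in> states A \<Longrightarrow> v \<in> states A \<Longrightarrow> in_degree (edges A) u = 0 \<Longrightarrow>
      in_degree (edges A) v > 0 \<Longrightarrow> (u, v) \<in> list_order xs"
    using assms by (auto simp: wheeler_automaton_def is_nfa_def listing_def wheeler_order_def)
  show n: "0 < length xs" using V s by auto
  obtain k where k: "k < length xs" "xs ! k = start A" using V s by (metis in_set_conv_nth)
  show "xs ! 0 = start A"
  proof (rule ccontr)
    assume "xs ! 0 \<noteq> start A"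
    moreover have "xs ! 0 \<in> states A" using n V nth_mem by blast
    ultimately have "(xs ! k, xs ! 0) \<in> list_order xs" using o[of "xs ! k" "xs ! 0"] d s k by auto
    then show False using list_order_nth_iff[OF V(2) k(1) n] by simp
  qed
qed

lemma indexed_wheeler_edges:
  assumes w: "wheeler_automaton A (list_order xs)" and l: "listing A xs es fs"
  shows "indexed_wheeler xs (edges A)"
proof -
  note st = wheeler_automaton_start[OF w l]
  have V: "set xs = states A" and D: "distinct xs" and s: "start A \<in> states A"
    and sub: "edges A \<subseteq> states A \<times> states A \<times> alphabet A"
    and fin: "finite (states A)" "finite (alphabet A)"
    and d: "\<And>v. v \<in> states A \<Longrightarrow> in_degree (edges A) v = 0 \<longleftrightarrow> v = start A"
    and m: "\<And>u v a u' v' a'. (u, v, a) \<in> edges A \<Longrightarrow> (u', v', a') \<in> edges A \<Longrightarrow>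
        (a < a' \<longrightarrow> (v, v') \<in> list_order xs) \<and>
        (a = a' \<and> (u, u') \<in> list_order xs \<longrightarrow> v = v' \<or> (v, v') \<in> list_order xs)"
    using w l by (auto simp: wheeler_automaton_def is_nfa_def listing_def wheeler_order_def)
  have finE: "finite (edges A)" using sub fin by (meson finite_SigmaI finite_subset)
  note mem = in_degree_pos_iff[OF finE]
  show ?thesis
  proof
    show "distinct xs" "finite (edges A)" "0 < length xs" by fact+
  next
    fix u v a assume e: "(u, v, a) \<in> edges A"
    then have "u \<in> set xs" "v \<in> set xs" using sub V by auto
    then obtain i k where ik: "i < length xs" "u = xs ! i" "k < length xs" "v = xs ! k"
      by (metis in_set_conv_nth)
    have "v \<noteq> start A" using d[of v] mem[of v] e s by auto
    then have "0 < k" using ik st by (cases k) auto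
    then show "\<exists>i k. i < length xs \<and> 0 < k \<and> k < length xs \<and> u = xs ! i \<and> v = xs ! k"
      using ik by blast
  next
    fix k assume k: "0 < k" "k < length xs"
    then have "xs ! k \<noteq> start A" using D st by (metis nth_eq_iff_index_eq less_numeral_extra(3))
    then show "\<exists>u a. (u, xs ! k, a) \<in> edges A" using d[of "xs ! k"] mem[of "xs ! k"] k V nth_mem[of k xs] by auto
  next
    fix i k a i' k' b
    assume "(xs ! i, xs ! k, a) \<in> edges A" "(xs ! i', xs ! k', b) \<in> edges A"
      "k < length xs" "k' < length xs" "a < b"
    then show "k < k'" using m D list_order_nth_iff by metis
  next
    fix i k a i' k'
    assume "(xs ! i, xs ! k, a) \<in> edges A" "(xs ! i', xs ! k', a) \<in> edges A"
      "i < i'" "i' < length xs" "k < length xs" "k' < length xs"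
    then show "k \<le> k'" using m[of "xs ! i" "xs ! k" a "xs ! i'" "xs ! k'" a] D
      by (auto simp: list_order_nth_iff nth_eq_iff_index_eq)
  qed
qed


section \<open>The implication graph\<close>

text \<open>The node \<open>i * n + j\<close> stands for \<open>us ! i < vs ! j\<close>. Both start states have index 0, and row 0 and
  column 0 encode comparisons with the common start state: the nodes of row 0 are true, those of
  column 0 below it are false. By monotonicity it suffices to use the node 0 as the true one and the
  node \<open>n\<close>, that is \<open>(1, 0)\<close>, as the false one. The predecessor \<open>i * n + j - n\<close> of a node in row 0 is
  0 by truncation.\<close>

definition cell_implications :: "nat \<Rightarrow> nat \<Rightarrow> nat rel" where
  "cell_implications m n =
     {(i * n + j, i * n + j - n) | i j. i < m \<and> j < n} \<union>
     {(i * n + j, Suc (i * n + j)) | i j. i < m \<and> Suc j < n}"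

text \<open>Two edges with the same label that both leave the common start state do not constrain each other;
  they get a trivial implication.\<close>

definition source_node ::
    "('v \<Rightarrow> nat) \<Rightarrow> nat \<Rightarrow> ('v \<times> 'v \<times> 'a::linorder) \<Rightarrow> ('v \<times> 'v \<times> 'a) \<Rightarrow> nat" where
  "source_node pos n = (\<lambda>(u, v, a) (u', v', b).
     if b < a then n else if a < b then 0
     else if pos u + pos u' = 0 then pos v + pos v' else pos u + pos u')"

definition target_node :: "('v \<Rightarrow> nat) \<Rightarrow> ('v \<times> 'v \<times> 'a) \<Rightarrow> ('v \<times> 'v \<times> 'a) \<Rightarrow> nat" where
  "target_node pos = (\<lambda>(u, v, a) (u', v', b). pos v + pos v')"

definition edge_implications ::
    "('v \<Rightarrow> nat) \<Rightarrow> nat \<Rightarrow> ('v \<times> 'v \<times> 'a::linorder) set \<Rightarrow> ('v \<times> 'v \<times> 'a) set \<Rightarrow> nat rel" where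
  "edge_implications pos n E F =
     (\<Union>e\<in>E. \<Union>f\<in>F. {(source_node pos n e f, target_node pos e f), (target_node pos e f, source_node pos n e f)})"

text \<open>Regroups the two families by cell, which is the form in which a nested loop over
  \<open>i\<close> and \<open>j\<close> adds them.\<close>

lemma cell_implications_UN:
  "cell_implications m n = (\<Union>i<m. \<Union>j<n.
     {(i * n + j, i * n + j - n)} \<union> (if Suc j < n then {(i * n + j, Suc (i * n + j))} else {}))"
proof -
  have "e \<in> cell_implications m n \<longleftrightarrow> (\<exists>i<m. \<exists>j<n. e = (i * n + j, i * n + j - n) \<or>
      (Suc j < n \<and> e = (i * n + j, Suc (i * n + j))))" for e
    unfolding cell_implications_def using Suc_lessD by blast
  moreover have "e \<in> (if c then {p} else {}) \<longleftrightarrow> c \<and> e = p" for e p :: "nat \<times> nat" and c by simp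
  ultimately show ?thesis
    by (intro set_eqI) (simp only: UN_iff Un_iff singleton_iff lessThan_iff Bex_def)
qed

text \<open>\<open>pos\<close> has the factor \<open>length vs\<close> built into the first list, so
  the node of a pair of states is a plain sum. One function can serve both lists because the state
  sets are disjoint.\<close>

locale wheeler_pair = A: indexed_wheeler us E + B: indexed_wheeler vs F
  for us vs :: "'v list" and E F :: "('v \<times> 'v \<times> 'a::linorder) set" +
  fixes s :: 'v and pos :: "'v \<Rightarrow> nat"
  assumes disjoint: "set us \<inter> set vs = {}"
    and fresh: "s \<notin> set us" "s \<notin> set vs"
    and pos_us: "i < length us \<Longrightarrow> pos (us ! i) = i * length vs"
    and pos_vs: "j < length vs \<Longrightarrow> pos (vs ! j) = j"
begin

abbreviation "m \<equiv> length us"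
abbreviation "n \<equiv> length vs"

definition implications :: "nat rel" where
  "implications = cell_implications m n \<union> edge_implications pos n E F"

definition reached :: "nat set" where
  "reached = implications\<^sup>* `` {0}"

definition union_states :: "'v set" where
  "union_states = (set us - {us ! 0}) \<union> (set vs - {vs ! 0}) \<union> {s}"

definition union_edges :: "('v \<times> 'v \<times> 'a) set" where
  "union_edges = redirect (us ! 0) s E \<union> redirect (vs ! 0) s F"

definition C_order :: "'v rel \<Rightarrow> bool" where
  "C_order r \<longleftrightarrow> wheeler_order union_states union_edges r \<and>
     (\<forall>u\<in>set us - {us ! 0}. \<forall>v\<in>set us - {us ! 0}. (u, v) \<in> r \<longleftrightarrow> (u, v) \<in> list_order us) \<and>
     (\<forall>u\<in>set vs - {vs ! 0}. \<forall>v\<in>set vs - {vs ! 0}. (u, v) \<in> r \<longleftrightarrow> (u, v) \<in> list_order vs)"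

section \<open>The union automaton in coordinates\<close>

definition us_state :: "nat \<Rightarrow> 'v" where
  "us_state i = (if i = 0 then s else us ! i)"

definition vs_state :: "nat \<Rightarrow> 'v" where
  "vs_state j = (if j = 0 then s else vs ! j)"

lemma us_neq_vs: "i < m \<Longrightarrow> j < n \<Longrightarrow> us ! i \<noteq> vs ! j"
  using disjoint by (metis disjoint_iff nth_mem)

lemma s_neq_us: "i < m \<Longrightarrow> us ! i \<noteq> s"
  using fresh by auto

lemma s_neq_vs: "j < n \<Longrightarrow> vs ! j \<noteq> s"
  using fresh by auto

lemma union_states_eq:
  "union_states = {s} \<union> {us ! i | i. 0 < i \<and> i < m} \<union> {vs ! j | j. 0 < j \<and> j < n}"
  unfolding union_states_def A.set_minus_first B.set_minus_first by auto

text \<open>Only the source has to be renamed: no edge enters a start state, so every target has a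
  positive index and keeps its name.\<close>

lemma redirect_us:
  "(u, v, c) \<in> redirect (us ! 0) s E \<longleftrightarrow>
     (\<exists>i k. i < m \<and> 0 < k \<and> k < m \<and> (us ! i, us ! k, c) \<in> E \<and> u = us_state i \<and> v = us ! k)" (is "?L \<longleftrightarrow> ?R")
proof
  assume ?L
  then obtain u' where u: "(u', v, c) \<in> E" "u = (if u' = us ! 0 then s else u')"
    by (auto simp: redirect_def)
  obtain i k where "i < m" "0 < k" "k < m" "u' = us ! i" "v = us ! k" using A.edge_nth u by blast
  moreover have "u = us_state i" using u A.distinct A.nonempty calculation
    by (auto simp: us_state_def nth_eq_iff_index_eq)
  ultimately show ?R using u by blast
next
  assume ?R
  then obtain i k where ik: "i < m" "0 < k" "k < m" "(us ! i, us ! k, c) \<in> E" "u = us_state i" "v = us ! k"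
    by blast
  then have "us_state i = (if us ! i = us ! 0 then s else us ! i)"
    using A.distinct A.nonempty by (auto simp: us_state_def nth_eq_iff_index_eq)
  then show ?L using ik unfolding redirect_def by (intro image_eqI[OF _ ik(4)]) simp
qed

lemma redirect_vs:
  "(u, v, c) \<in> redirect (vs ! 0) s F \<longleftrightarrow>
     (\<exists>j k. j < n \<and> 0 < k \<and> k < n \<and> (vs ! j, vs ! k, c) \<in> F \<and> u = vs_state j \<and> v = vs ! k)" (is "?L \<longleftrightarrow> ?R")
proof
  assume ?L
  then obtain u' where u: "(u', v, c) \<in> F" "u = (if u' = vs ! 0 then s else u')"
    by (auto simp: redirect_def)
  obtain i k where "i < n" "0 < k" "k < n" "u' = vs ! i" "v = vs ! k" using B.edge_nth u by blast
  moreover have "u = vs_state i" using u B.distinct B.nonempty calculation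
    by (auto simp: vs_state_def nth_eq_iff_index_eq)
  ultimately show ?R using u by blast
next
  assume ?R
  then obtain i k where ik: "i < n" "0 < k" "k < n" "(vs ! i, vs ! k, c) \<in> F" "u = vs_state i" "v = vs ! k"
    by blast
  then have "vs_state i = (if vs ! i = vs ! 0 then s else vs ! i)"
    using B.distinct B.nonempty by (auto simp: vs_state_def nth_eq_iff_index_eq)
  then show ?L using ik unfolding redirect_def by (intro image_eqI[OF _ ik(4)]) simp
qed

lemma finite_union_edges: "finite union_edges"
  using A.finite_edges B.finite_edges by (simp add: union_edges_def redirect_def)

lemma in_degree_s: "in_degree union_edges s = 0"
proof -
  have "\<not> (\<exists>u c. (u, s, c) \<in> union_edges)"
    using us_neq_vs s_neq_us s_neq_vs B.nonempty by (auto simp: union_edges_def redirect_us redirect_vs)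
  then show ?thesis using in_degree_pos_iff[OF finite_union_edges, of s] by blast
qed

lemma in_degree_us:
  assumes "0 < i" "i < m"
  shows "in_degree union_edges (us ! i) > 0"
proof -
  obtain u c where e: "(u, us ! i, c) \<in> E" using A.in_edge assms by blast
  then obtain k where "k < m" "u = us ! k" using A.edge_nth by blast
  then have "(if k = 0 then s else us ! k, us ! i, c) \<in> union_edges"
    unfolding union_edges_def Un_iff redirect_us us_state_def using e assms by blast
  then show ?thesis using in_degree_pos_iff[OF finite_union_edges] by blast
qed

lemma in_degree_vs:
  assumes "0 < i" "i < n"
  shows "in_degree union_edges (vs ! i) > 0"
proof -
  obtain u c where e: "(u, vs ! i, c) \<in> F" using B.in_edge assms by blast
  then obtain k where "k < n" "u = vs ! k" using B.edge_nth by blast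
  then have "(if k = 0 then s else vs ! k, vs ! i, c) \<in> union_edges"
    unfolding union_edges_def Un_iff redirect_vs vs_state_def using e assms by blast
  then show ?thesis using in_degree_pos_iff[OF finite_union_edges] by blast
qed

lemma edge_implication_cases:
  assumes "(x, y) \<in> edge_implications pos n E F"
  obtains i k j l c d z w where "i < m" "0 < k" "k < m" "j < n" "0 < l" "l < n"
    "(us ! i, us ! k, c) \<in> E" "(vs ! j, vs ! l, d) \<in> F" "w = k * n + l"
    "z = (if d < c then n else if c < d then 0 else if i = 0 \<and> j = 0 then w else i * n + j)"
    "(x, y) = (z, w) \<or> (x, y) = (w, z)"
proof -
  obtain e f where ef: "e \<in> E" "f \<in> F" "(x, y) = (source_node pos n e f, target_node pos e f) \<or>
      (x, y) = (target_node pos e f, source_node pos n e f)"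
    using assms by (auto simp: edge_implications_def)
  obtain u v c u' v' d where e: "e = (u, v, c)" "f = (u', v', d)" by (cases e, cases f)
  obtain i k where ik: "i < m" "0 < k" "k < m" "u = us ! i" "v = us ! k"
    using A.edge_nth ef e by blast
  obtain j l where jl: "j < n" "0 < l" "l < n" "u' = vs ! j" "v' = vs ! l"
    using B.edge_nth ef e by blast
  have 1: "target_node pos e f = k * n + l"
    using ik jl e by (simp add: target_node_def pos_us pos_vs)
  \<comment> \<open>Here \<open>0 < n\<close> matters: only then does \<open>i * n + j = 0\<close>
    mean that both sources are start states.\<close>
  have 2: "source_node pos n e f =
      (if d < c then n else if c < d then 0 else if i = 0 \<and> j = 0 then k * n + l else i * n + j)"
    using ik jl e B.nonempty by (auto simp: source_node_def pos_us pos_vs)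
  show thesis by (rule that[of i k j l c d]) (use ik jl e ef 1 2 in auto)
qed

lemma edge_implicationI:
  assumes "i < m" "0 < k" "k < m" "j < n" "0 < l" "l < n"
    "(us ! i, us ! k, c) \<in> E" "(vs ! j, vs ! l, d) \<in> F" "w = k * n + l"
    "z = (if d < c then n else if c < d then 0 else if i = 0 \<and> j = 0 then w else i * n + j)"
  shows "(z, w) \<in> implications" "(w, z) \<in> implications"
proof -
  let ?e = "(us ! i, us ! k, c)" and ?f = "(vs ! j, vs ! l, d)"
  have 1: "target_node pos ?e ?f = w"
    using assms by (simp add: target_node_def pos_us pos_vs)
  have 2: "source_node pos n ?e ?f = z"
    using assms B.nonempty by (auto simp: source_node_def pos_us pos_vs)
  show "(z, w) \<in> implications" "(w, z) \<in> implications"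
    unfolding implications_def edge_implications_def
    using assms(7,8) 1 2 by blast+
qed

text \<open>Supplies the bound on the number of nodes that the search can put into its queue. The
  constant \<open>n\<close> has to be covered besides the cells, and \<open>n \<le> m * n\<close>
  follows from \<open>0 < m\<close> alone.\<close>

lemma implications_bounded: "implications \<subseteq> {..m * n} \<times> {..m * n}"
proof -
  have b: "i * n + j < m * n" if "i < m" "j < n" for i j
  proof -
    have "Suc i * n \<le> m * n" using that by (intro mult_right_mono) auto
    then show ?thesis using that by simp
  qed
  have "x \<le> m * n \<and> y \<le> m * n" if "(x, y) \<in> cell_implications m n" for x y
    using that unfolding cell_implications_def using b by (auto intro: less_imp_le simp: Suc_leI)
      (meson b diff_le_self le_trans less_imp_le)
  moreover have "x \<le> m * n \<and> y \<le> m * n" if xy: "(x, y) \<in> edge_implications pos n E F" for x y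
    using xy
  proof (rule edge_implication_cases)
    fix i k j l c d z w
    assume h: "i < m" "0 < k" "k < m" "j < n" "0 < l" "l < n" "w = k * n + l"
      "z = (if d < c then n else if c < d then 0 else if i = 0 \<and> j = 0 then w else i * n + j)"
      "(x, y) = (z, w) \<or> (x, y) = (w, z)"
    have "n \<le> m * n" using A.nonempty by (cases m) auto
    then have "z \<le> m * n" "w \<le> m * n" using h b[of k l] b[of i j] by auto
    then show "x \<le> m * n \<and> y \<le> m * n" using h by auto
  qed
  ultimately show ?thesis unfolding implications_def by auto
qed

text \<open>The statements that hold in a C-order form a set that is closed under the implications, contains
  the node 0 and omits the node \<open>n\<close>.\<close>

lemma C_order_imp_not_reached:
  assumes "C_order r"
  shows "n \<notin> reached"
proof -
  have tr: "trans r" and ir: "irrefl r" and tot: "total_on union_states r"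
    using assms
    by (auto simp: C_order_def wheeler_order_def ordering_on_def strict_linear_order_on_def)
  have dg: "(u, v) \<in> r" if "u \<in> union_states" "v \<in> union_states" "in_degree union_edges u = 0"
      "in_degree union_edges v > 0" for u v
    using assms that by (simp add: C_order_def wheeler_order_def)
  have wh: "(c < c' \<longrightarrow> (v, v') \<in> r) \<and> (c = c' \<and> (u, u') \<in> r \<longrightarrow> v = v' \<or> (v, v') \<in> r)"
    if "(u, v, c) \<in> union_edges" "(u', v', c') \<in> union_edges" for u v c u' v' c'
  proof -
    have "\<forall>(u, v, c)\<in>union_edges. \<forall>(u', v', c')\<in>union_edges.
        (c < c' \<longrightarrow> (v, v') \<in> r) \<and> (c = c' \<and> (u, u') \<in> r \<longrightarrow> v = v' \<or> (v, v') \<in> r)"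
      using assms by (simp add: C_order_def wheeler_order_def)
    from bspec[OF this that(1)] that(2) show ?thesis by auto
  qed
  have lab: "(v, v') \<in> r"
    if "(u, v, c) \<in> union_edges" "(u', v', c') \<in> union_edges" "c < c'" for u v c u' v' c'
    using wh that by blast
  have mon: "v = v' \<or> (v, v') \<in> r"
    if "(u, v, c) \<in> union_edges" "(u', v', c) \<in> union_edges" "(u, u') \<in> r" for u v c u' v'
    using wh that by blast
  have r0: "(u, v) \<in> r \<longleftrightarrow> (u, v) \<in> list_order us"
      if "u \<in> set us - {us ! 0}" "v \<in> set us - {us ! 0}" for u v
    using assms that by (simp add: C_order_def)
  have r1: "(u, v) \<in> r \<longleftrightarrow> (u, v) \<in> list_order vs"
      if "u \<in> set vs - {vs ! 0}" "v \<in> set vs - {vs ! 0}" for u v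
    using assms that by (simp add: C_order_def)
  have asym: "(u, v) \<in> r \<Longrightarrow> (v, u) \<notin> r" for u v using tr ir by (meson irrefl_def transD)
  have us_r: "(us ! i, us ! i') \<in> r" if "0 < i" "i < i'" "i' < m" for i i'
    using that r0[of "us ! i" "us ! i'"] A.first_notin_tl[of i] A.first_notin_tl[of i']
    by (simp add: list_order_nth_iff[OF A.distinct])
  have vs_r: "(vs ! i, vs ! i') \<in> r" if "0 < i" "i < i'" "i' < n" for i i'
    using that r1[of "vs ! i" "vs ! i'"] B.first_notin_tl[of i] B.first_notin_tl[of i']
    by (simp add: list_order_nth_iff[OF B.distinct])
  have s_us: "(s, us ! i) \<in> r" if "0 < i" "i < m" for i
    using that by (intro dg) (auto simp: union_states_eq in_degree_s in_degree_us)
  have s_vs: "(s, vs ! i) \<in> r" if "0 < i" "i < n" for i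
    using that by (intro dg) (auto simp: union_states_eq in_degree_s in_degree_vs)
  \<comment> \<open>The true statements as a set of numbers, a node being decoded by
    \<open>div\<close> and \<open>mod\<close>. Row 0 is put in and the rest of column 0 is left out
    by hand, because there the comparison is with \<open>s\<close> instead of \<open>us ! 0\<close>
    or \<open>vs ! 0\<close>.\<close>
  define S where "S = {x. x div n = 0 \<or> (0 < x mod n \<and> (us ! (x div n), vs ! (x mod n)) \<in> r)}"
  have S: "i * n + j \<in> S \<longleftrightarrow> i = 0 \<or> (0 < j \<and> (us ! i, vs ! j) \<in> r)" if "j < n" for i j
  proof -
    have "(i * n + j) div n = i" using that by (metis add.right_neutral div_less div_mult_self3 not_less0)
    then show ?thesis using that by (simp add: S_def)
  qed
  have n: "n \<notin> S" using B.nonempty by (simp add: S_def)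
  have z: "0 \<in> S" by (simp add: S_def)
  have cell: "y \<in> S" if "x \<in> S" and xy: "(x, y) \<in> cell_implications m n" for x y
  proof -
    consider (1) i j where "i < m" "j < n" "x = i * n + j" "y = i * n + j - n" |
      (2) i j where "i < m" "Suc j < n" "x = i * n + j" "y = Suc (i * n + j)"
      using xy unfolding cell_implications_def by blast
    then show ?thesis
    proof cases
      case 1
      show ?thesis
      proof (cases i)
        case 0
        then show ?thesis using 1 z by simp
      next
        case (Suc i')
        then have y: "y = i' * n + j" using 1 by simp
        have h: "0 < j" "(us ! i, vs ! j) \<in> r" using S[of j i] 1 Suc that(1) by auto
        show ?thesis
        proof (cases "i' = 0")
          case False
          then have "(us ! i', us ! i) \<in> r" using us_r Suc 1 by simp
          from transD[OF tr this h(2)] show ?thesis using h(1) S[of j i'] 1 y by simp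
        qed (use S[of j i'] 1 y in simp)
      qed
    next
      case 2
      show ?thesis
      proof (cases "i = 0")
        case False
        then have h: "0 < j" "(us ! i, vs ! j) \<in> r" using S[of j i] 2 that(1) by auto
        then have "(vs ! j, vs ! Suc j) \<in> r" using vs_r 2 by simp
        from transD[OF tr h(2) this] show ?thesis using S[of "Suc j" i] 2 by simp
      qed (use S[of "Suc j" i] 2 in simp)
    qed
  qed
  have pair: "x \<in> S \<longleftrightarrow> y \<in> S" if xy: "(x, y) \<in> edge_implications pos n E F" for x y
    using xy
  proof (rule edge_implication_cases)
    fix i k j l c d z w
    assume h: "i < m" "0 < k" "k < m" "j < n" "0 < l" "l < n"
      and e: "(us ! i, us ! k, c) \<in> E" "(vs ! j, vs ! l, d) \<in> F"
      and w: "w = k * n + l"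
      and z': "z = (if d < c then n else if c < d then 0 else if i = 0 \<and> j = 0 then w else i * n + j)"
      and xy: "(x, y) = (z, w) \<or> (x, y) = (w, z)"
    have e1: "(us_state i, us ! k, c) \<in> union_edges" and e2: "(vs_state j, vs ! l, d) \<in> union_edges"
      unfolding union_edges_def Un_iff redirect_us redirect_vs using h e by blast+
    have neq: "us ! k \<noteq> vs ! l" using us_neq_vs s_neq_us h by blast
    have Sw: "w \<in> S \<longleftrightarrow> (us ! k, vs ! l) \<in> r" using h w S by simp
    have "z \<in> S \<longleftrightarrow> w \<in> S"
    proof (cases c d rule: linorder_cases)
      case less
      then show ?thesis using lab[OF e1 e2] Sw z' z by auto
    next
      case greater
      then show ?thesis using lab[OF e2 e1] asym[of "vs ! l" "us ! k"] Sw z' n by auto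
    next
      case equal
      \<comment> \<open>\<open>neq\<close> excludes the alternative of equal targets, so each order
        of the sources settles the order of the targets. As distinct sources are comparable, the two
        directions together give the equivalence.\<close>
      have fwd: "w \<in> S" if "(us_state i, vs_state j) \<in> r"
        using mon[OF e1 e2[folded equal] that] neq Sw by auto
      have bwd: "w \<notin> S" if "(vs_state j, us_state i) \<in> r"
        using mon[OF e2[folded equal] e1 that] neq Sw asym[of "vs ! l" "us ! k"] by auto
      show ?thesis
      proof (cases "i = 0 \<and> j = 0")
        case True
        then show ?thesis using equal z' by simp
      next
        case False
        then have zz: "z = i * n + j" using equal z' by auto
        consider "i = 0" "0 < j" | "0 < i" "j = 0" | "0 < i" "0 < j" using False by auto
        then show ?thesis
        proof cases
          case 1
          then show ?thesis using fwd s_vs[of j] h S[of j i] zz by (auto simp: us_state_def vs_state_def)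
        next
          case 2
          then show ?thesis using bwd s_us[of i] h S[of j i] zz by (auto simp: us_state_def vs_state_def)
        next
          case 3
          have "us ! i \<in> union_states" "vs ! j \<in> union_states" "us ! i \<noteq> vs ! j"
            using 3 h us_neq_vs s_neq_us by (auto simp: union_states_eq)
          then have "(us ! i, vs ! j) \<in> r \<or> (vs ! j, us ! i) \<in> r"
            using tot by (auto simp: total_on_def)
          then show ?thesis using 3 fwd bwd h S[of j i] zz asym[of "us ! i" "vs ! j"] by (auto simp: us_state_def vs_state_def)
        qed
      qed
    qed
    then show "x \<in> S \<longleftrightarrow> y \<in> S" using xy by auto
  qed
  have "x \<in> S" if "(0, x) \<in> implications\<^sup>*" for x
    using that
  proof (induction rule: rtrancl_induct)
    case (step y z)
    then have "(y, z) \<in> cell_implications m n \<or> (y, z) \<in> edge_implications pos n E F"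
      by (simp add: implications_def)
    then show ?case using cell[of y z] pair[of y z] step.IH by auto
  qed (use z in simp)
  then show ?thesis using n by (auto simp: reached_def)
qed

section \<open>From the reached set to a C-order\<close>

lemma reached_0: "0 \<in> reached" by (simp add: reached_def)

lemma reached_step: "x \<in> reached \<Longrightarrow> (x, y) \<in> implications \<Longrightarrow> y \<in> reached"
  by (auto simp: reached_def intro: rtrancl_into_rtrancl)

lemma reached_Suc: "i < m \<Longrightarrow> Suc j < n \<Longrightarrow> i * n + j \<in> reached \<Longrightarrow> i * n + Suc j \<in> reached"
  by (rule reached_step[of "i * n + j"]) (auto simp: implications_def cell_implications_def)

lemma reached_pred:
  assumes "Suc i < m" "j < n" "Suc i * n + j \<in> reached"
  shows "i * n + j \<in> reached"
proof -
  have "(Suc i * n + j, Suc i * n + j - n) \<in> implications"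
    using assms unfolding implications_def cell_implications_def by blast
  then show ?thesis using reached_step[OF assms(3)] by simp
qed

text \<open>A path of cell implications: along row \<open>i\<close> from column \<open>j\<close> to
  \<open>j'\<close>, then through the rows from \<open>i\<close> back to \<open>i'\<close>.\<close>

lemma reached_mono:
  assumes "i' \<le> i" "i < m" "j \<le> j'" "j' < n" "i * n + j \<in> reached"
  shows "i' * n + j' \<in> reached"
proof -
  have "i * n + j' \<in> reached" using assms(3,4)
  proof (induction j' rule: dec_induct)
    case base
    then show ?case using assms by simp
  next
    case (step k)
    then show ?case using reached_Suc[of i k] assms by simp
  qed
  with assms(1) show ?thesis
  proof (induction i' rule: inc_induct)
    case (step k)
    then show ?case using reached_pred[of k j'] assms by simp
  qed simp
qed

lemma reached_row_0: "j < n \<Longrightarrow> j \<in> reached"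
  using reached_mono[of 0 0 0 j] reached_0 A.nonempty by simp

text \<open>From a reached node of column 0 the row steps would lead to row 1, that is, to the node
  \<open>n\<close>. This is why a single false node speaks for the whole column.\<close>

lemma not_reached_column_0: "n \<notin> reached \<Longrightarrow> 0 < i \<Longrightarrow> i < m \<Longrightarrow> i * n \<notin> reached"
  using reached_mono[of 1 i 0 0] B.nonempty by auto

text \<open>Index 0 in the first two rules puts \<open>s\<close> before every other state, so the
  mixed rules can be confined to positive indices. Transitivity and totality are never proved for
  this relation: the merge yields a list sorted by it, and the order of a distinct list is linear
  anyway.\<close>

inductive before :: "'v \<Rightarrow> 'v \<Rightarrow> bool" where
  us_us: "i < k \<Longrightarrow> i < m \<Longrightarrow> k < m \<Longrightarrow> before (us_state i) (us ! k)"
| vs_vs: "j < l \<Longrightarrow> j < n \<Longrightarrow> l < n \<Longrightarrow> before (vs_state j) (vs ! l)"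
| us_vs: "0 < i \<Longrightarrow> i < m \<Longrightarrow> 0 < j \<Longrightarrow> j < n \<Longrightarrow> i * n + j \<in> reached \<Longrightarrow> before (us ! i) (vs ! j)"
| vs_us: "0 < i \<Longrightarrow> i < m \<Longrightarrow> 0 < j \<Longrightarrow> j < n \<Longrightarrow> i * n + j \<notin> reached \<Longrightarrow> before (vs ! j) (us ! i)"

lemmas nth_simps = us_neq_vs us_neq_vs[symmetric] s_neq_us s_neq_us[symmetric] s_neq_vs s_neq_vs[symmetric]
  nth_eq_iff_index_eq[OF A.distinct] nth_eq_iff_index_eq[OF B.distinct]

lemma before_us_us:
  assumes "i < m" "0 < k" "k < m"
  shows "before (us_state i) (us ! k) \<longleftrightarrow> i < k"
proof
  assume "before (us_state i) (us ! k)"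
  then show "i < k" by (cases rule: before.cases) (use assms in \<open>auto simp: us_state_def nth_simps split: if_splits\<close>)
qed (use assms in \<open>auto intro: before.intros\<close>)

lemma before_vs_vs:
  assumes "i < n" "0 < k" "k < n"
  shows "before (vs_state i) (vs ! k) \<longleftrightarrow> i < k"
proof
  assume "before (vs_state i) (vs ! k)"
  then show "i < k" by (cases rule: before.cases) (use assms in \<open>auto simp: vs_state_def nth_simps split: if_splits\<close>)
qed (use assms in \<open>auto intro: before.intros\<close>)

lemma before_us_vs:
  assumes "0 < i" "i < m" "0 < j" "j < n"
  shows "before (us ! i) (vs ! j) \<longleftrightarrow> i * n + j \<in> reached"
proof
  assume "before (us ! i) (vs ! j)"
  then show "i * n + j \<in> reached"
    by (cases rule: before.cases) (use assms in \<open>auto simp: vs_state_def nth_simps split: if_splits\<close>)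
qed (use assms in \<open>auto intro: before.intros\<close>)

lemma before_vs_us:
  assumes "0 < i" "i < m" "0 < j" "j < n"
  shows "before (vs ! j) (us ! i) \<longleftrightarrow> i * n + j \<notin> reached"
proof
  assume "before (vs ! j) (us ! i)"
  then show "i * n + j \<notin> reached"
    by (cases rule: before.cases) (use assms in \<open>auto simp: us_state_def nth_simps split: if_splits\<close>)
qed (use assms in \<open>auto intro: before.intros\<close>)

lemma not_before_s: "\<not> before u s"
  by (auto simp: nth_simps elim!: before.cases)

lemma before_target:
  assumes "before u v"
  obtains k where "0 < k" "k < m" "v = us ! k" | l where "0 < l" "l < n" "v = vs ! l"
  using assms by (cases rule: before.cases) (metis that gr_implies_not0 gr0I)+

lemma not_before_sym:
  assumes "before u v"
  shows "\<not> before v u"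
proof
  assume "before v u"
  then show False
  proof (cases rule: before_target)
    case u: (1 i)
    from assms show False
    proof (cases rule: before_target)
      case v: (1 k)
      then show False using assms \<open>before v u\<close> u before_us_us[of i k] before_us_us[of k i] by (simp add: us_state_def)
    next
      case v: (2 l)
      then show False using assms \<open>before v u\<close> u before_us_vs[of i l] before_vs_us[of i l] by simp
    qed
  next
    case u: (2 j)
    from assms show False
    proof (cases rule: before_target)
      case v: (1 k)
      then show False using assms \<open>before v u\<close> u before_us_vs[of k j] before_vs_us[of k j] by simp
    next
      case v: (2 l)
      then show False using assms \<open>before v u\<close> u before_vs_vs[of j l] before_vs_vs[of l j] by (simp add: vs_state_def)
    qed
  qed
qed

text \<open>Sortedness gives one direction. For the other, two states in the wrong positions would
  be related both ways, against \<open>not_before_sym\<close>.\<close>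

lemma list_order_before:
  assumes "distinct xs" "sorted_wrt before xs" "u \<in> set xs" "v \<in> set xs"
  shows "(u, v) \<in> list_order xs \<longleftrightarrow> before u v"
proof
  assume "(u, v) \<in> list_order xs"
  then show "before u v" using assms(2) by (auto simp: list_order_def sorted_wrt_iff_nth_less)
next
  assume uv: "before u v"
  obtain i j where ij: "i < length xs" "j < length xs" "u = xs ! i" "v = xs ! j"
    using assms(3,4) by (metis in_set_conv_nth)
  consider "i < j" | "i = j" | "j < i" by linarith
  then show "(u, v) \<in> list_order xs"
  proof cases
    case 1
    then show ?thesis using ij by (auto simp: list_order_def)
  next
    case 2
    then show ?thesis using uv not_before_sym ij by blast
  next
    case 3
    then have "before v u" using ij assms(2) by (simp add: sorted_wrt_iff_nth_less)
    then show ?thesis using uv not_before_sym by blast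
  qed
qed

lemma union_edge_cases:
  assumes "(u, v, c) \<in> union_edges"
  obtains i k where "i < m" "0 < k" "k < m" "(us ! i, us ! k, c) \<in> E" "u = us_state i" "v = us ! k"
    | j l where "j < n" "0 < l" "l < n" "(vs ! j, vs ! l, c) \<in> F" "u = vs_state j" "v = vs ! l"
  using assms unfolding union_edges_def Un_iff redirect_us redirect_vs by blast

text \<open>Extends the correspondence between \<open>before\<close> and \<open>reached\<close> to
  index 0, where a source is \<open>s\<close>: row 0 is reached, and column 0 below it is not as
  long as \<open>n\<close> is not. The facts \<open>0 < j\<close> and \<open>0 < i\<close> record
  that nothing precedes \<open>s\<close>.\<close>

lemma before_sources:
  assumes "i < m" "j < n"
  shows "before (us_state i) (vs_state j) \<Longrightarrow> 0 < j \<and> i * n + j \<in> reached"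
    and "n \<notin> reached \<Longrightarrow> before (vs_state j) (us_state i) \<Longrightarrow> 0 < i \<and> i * n + j \<notin> reached"
proof -
  assume ab: "before (us_state i) (vs_state j)"
  then have "0 < j" using not_before_s by (auto simp: vs_state_def intro: gr0I)
  then show "0 < j \<and> i * n + j \<in> reached"
    using ab assms reached_row_0[of j] before_us_vs[of i j] by (cases "i = 0") (auto simp: us_state_def vs_state_def)
next
  assume ba: "before (vs_state j) (us_state i)" and n: "n \<notin> reached"
  then have "0 < i" using not_before_s by (auto simp: us_state_def intro: gr0I)
  then show "0 < i \<and> i * n + j \<notin> reached"
    using ba n assms not_reached_column_0[of i] before_vs_us[of i j]
    by (cases "j = 0") (auto simp: us_state_def vs_state_def)
qed

text \<open>Both implications of the pair are present, so \<open>z\<close> and \<open>w\<close> are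
  reached together or not at all. The condition on labels and sources decides this for
  \<open>z\<close>, and \<open>w\<close> translates it to the targets. The trivial implication
  cannot interfere, since for \<open>i = j = 0\<close> the sources are not related by
  \<open>before\<close>.\<close>

lemma edge_pair_before:
  assumes ik: "i < m" "0 < k" "k < m" and jl: "j < n" "0 < l" "l < n"
    and e: "(us ! i, us ! k, c) \<in> E" and f: "(vs ! j, vs ! l, d) \<in> F"
    and n: "n \<notin> reached"
  shows "c < d \<or> c = d \<and> before (us_state i) (vs_state j) \<Longrightarrow> before (us ! k) (vs ! l)"
    and "d < c \<or> c = d \<and> before (vs_state j) (us_state i) \<Longrightarrow> before (vs ! l) (us ! k)"
proof -
  define w where "w = k * n + l"
  define z where "z = (if d < c then n else if c < d then 0 else if i = 0 \<and> j = 0 then w else i * n + j)"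
  have zw: "z \<in> reached \<longleftrightarrow> w \<in> reached"
    using edge_implicationI[OF ik jl e f w_def z_def] reached_step by blast
  have kl: "before (us ! k) (vs ! l) \<longleftrightarrow> w \<in> reached" "before (vs ! l) (us ! k) \<longleftrightarrow> w \<notin> reached"
    using before_us_vs before_vs_us ik jl by (simp_all add: w_def)
  {
    assume h: "c < d \<or> c = d \<and> before (us_state i) (vs_state j)"
    then have "z \<in> reached" using before_sources(1)[OF ik(1) jl(1)] reached_0
      by (auto simp: z_def)
    then show "before (us ! k) (vs ! l)" using zw kl by simp
  next
    assume h: "d < c \<or> c = d \<and> before (vs_state j) (us_state i)"
    then have "z \<notin> reached" using before_sources(2)[OF ik(1) jl(1) n] n
      by (auto simp: z_def)
    then show "before (vs ! l) (us ! k)" using zw kl by simp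
  }
qed

lemma before_C_order:
  assumes xs: "distinct xs" "set xs = union_states" "sorted_wrt before xs" and n: "n \<notin> reached"
  shows "C_order (list_order xs)"
proof -
  note lo = list_order_before[OF xs(1,3), unfolded xs(2)]
  have mem: "s \<in> union_states" "\<And>k. 0 < k \<Longrightarrow> k < m \<Longrightarrow> us ! k \<in> union_states"
    "\<And>l. 0 < l \<Longrightarrow> l < n \<Longrightarrow> vs ! l \<in> union_states"
    by (auto simp: union_states_eq)
  have memab: "i < m \<Longrightarrow> us_state i \<in> union_states" "j < n \<Longrightarrow> vs_state j \<in> union_states" for i j
    using mem by (auto simp: us_state_def vs_state_def)
  have "(u, v) \<in> list_order xs"
    if uv: "u \<in> union_states" "v \<in> union_states" and d: "in_degree union_edges u = 0" "in_degree union_edges v > 0"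
    for u v
  proof -
    have "\<not> (\<exists>k. u = us ! k \<and> 0 < k \<and> k < m)" "\<not> (\<exists>l. u = vs ! l \<and> 0 < l \<and> l < n)"
      using d(1) in_degree_us in_degree_vs by (metis less_numeral_extra(3))+
    then have "u = s" using uv(1) unfolding union_states_eq by blast
    moreover have "v \<noteq> s" using d in_degree_s by auto
    ultimately have "before u v" using uv before.us_us[of 0] before.vs_vs[of 0] A.nonempty B.nonempty
      unfolding union_states_eq by (auto simp: us_state_def vs_state_def)
    then show ?thesis using lo uv by simp
  qed
  moreover have "(c < c' \<longrightarrow> (v, v') \<in> list_order xs) \<and>
      (c = c' \<and> (u, u') \<in> list_order xs \<longrightarrow> v = v' \<or> (v, v') \<in> list_order xs)"
    if e: "(u, v, c) \<in> union_edges" and f: "(u', v', c') \<in> union_edges" for u v c u' v' c'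
    using e
  proof (cases rule: union_edge_cases)
    case e: (1 i k)
    from f show ?thesis
    proof (cases rule: union_edge_cases)
      case f: (1 i' k')
      have 1: "(v, v') \<in> list_order xs \<longleftrightarrow> k < k'" using e f lo mem before_us_us[of k k'] by (simp add: us_state_def)
      \<comment> \<open>\<open>before_us_us\<close> needs a positive second index; a source with
        index 0 is \<open>s\<close>, which has no predecessor.\<close>
      have 2: "i < i'" if "(u, u') \<in> list_order xs"
      proof -
        have bf: "before (us_state i) (us_state i')" using that lo memab e(1,5) f(1,5) by simp
        then have "0 < i'" using not_before_s[of "us_state i"] by (cases i') (auto simp: us_state_def)
        then show ?thesis using bf before_us_us[of i i'] e(1) f(1) by (simp add: us_state_def)
      qed
      show ?thesis using 1 2 A.label_mono[OF e(4) f(4)] A.source_mono[of i k c i' k'] e f by fastforce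
    next
      case f: (2 j' l')
      then show ?thesis using edge_pair_before(1)[OF e(1-3) f(1-3) e(4) f(4) n] e lo mem memab by simp
    qed
  next
    case e: (2 j l)
    from f show ?thesis
    proof (cases rule: union_edge_cases)
      case f: (1 i' k')
      then show ?thesis using edge_pair_before(2)[OF f(1-3) e(1-3) f(4) e(4) n] e lo mem memab by simp
    next
      case f: (2 j' l')
      have 1: "(v, v') \<in> list_order xs \<longleftrightarrow> l < l'" using e f lo mem before_vs_vs[of l l'] by (simp add: vs_state_def)
      have 2: "j < j'" if "(u, u') \<in> list_order xs"
      proof -
        have bf: "before (vs_state j) (vs_state j')" using that lo memab e(1,5) f(1,5) by simp
        then have "0 < j'" using not_before_s[of "vs_state j"] by (cases j') (auto simp: vs_state_def)
        then show ?thesis using bf before_vs_vs[of j j'] e(1) f(1) by (simp add: vs_state_def)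
      qed
      show ?thesis using 1 2 B.label_mono[OF e(4) f(4)] B.source_mono[of j l c j' l'] e f by fastforce
    qed
  qed
  moreover have "(u, v) \<in> list_order xs \<longleftrightarrow> (u, v) \<in> list_order us"
    if uv: "u \<in> set us - {us ! 0}" "v \<in> set us - {us ! 0}" for u v
  proof -
    obtain i k where "0 < i" "i < m" "u = us ! i" "0 < k" "k < m" "v = us ! k"
      using uv unfolding A.set_minus_first by blast
    then show ?thesis using lo mem before_us_us[of i k] list_order_nth_iff[OF A.distinct, of i k]
      by (simp add: us_state_def)
  qed
  moreover have "(u, v) \<in> list_order xs \<longleftrightarrow> (u, v) \<in> list_order vs"
    if uv: "u \<in> set vs - {vs ! 0}" "v \<in> set vs - {vs ! 0}" for u v
  proof -
    obtain i k where "0 < i" "i < n" "u = vs ! i" "0 < k" "k < n" "v = vs ! k"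
      using uv unfolding B.set_minus_first by blast
    then show ?thesis using lo mem before_vs_vs[of i k] list_order_nth_iff[OF B.distinct, of i k]
      by (simp add: vs_state_def)
  qed
  ultimately show ?thesis
    using ordering_on_list_order[OF xs(1)] unfolding C_order_def wheeler_order_def xs(2)
    by (simp add: Ball_def split_paired_All)
qed

section \<open>The merge as a sequence of list extensions\<close>

lemma reached_le: "x \<in> reached \<Longrightarrow> x \<le> m * n"
  using implications_bounded by (auto simp: reached_def elim: rtranclE)

text \<open>The state of the merge in which \<open>us ! i\<close> and \<open>vs ! j\<close> are the next candidates.\<close>

definition merged :: "nat \<Rightarrow> nat \<Rightarrow> 'v list \<Rightarrow> bool" where
  "merged i j xs \<longleftrightarrow> 0 < i \<and> i \<le> m \<and> 0 < j \<and> j \<le> n \<and> distinct xs \<and> sorted_wrt before xs \<and>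
     set xs = insert s ({us ! k | k. 0 < k \<and> k < i} \<union> {vs ! l | l. 0 < l \<and> l < j}) \<and>
     (\<forall>i' j'. 0 < i' \<and> i' < i \<and> j \<le> j' \<and> j' < n \<longrightarrow> i' * n + j' \<in> reached) \<and>
     (\<forall>i' j'. 0 < j' \<and> j' < j \<and> i \<le> i' \<and> i' < m \<longrightarrow> i' * n + j' \<notin> reached)"

lemma merged_start: "merged 1 1 [s]"
  using A.nonempty B.nonempty unfolding merged_def by (simp add: Suc_le_eq)

lemma before_s: "0 < i \<Longrightarrow> i < m \<Longrightarrow> before s (us ! i)" "0 < j \<Longrightarrow> j < n \<Longrightarrow> before s (vs ! j)"
  using us_us[of 0 i] vs_vs[of 0 j] A.nonempty B.nonempty by (simp_all add: us_state_def vs_state_def)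

lemma before_us: "0 < i \<Longrightarrow> i < k \<Longrightarrow> k < m \<Longrightarrow> before (us ! i) (us ! k)"
  using us_us[of i k] by (auto simp: us_state_def)

lemma before_vs: "0 < i \<Longrightarrow> i < k \<Longrightarrow> k < n \<Longrightarrow> before (vs ! i) (vs ! k)"
  using vs_vs[of i k] by (auto simp: vs_state_def)

text \<open>All listed \<open>vs ! l\<close> have \<open>l < j\<close>, and the invariant says that
  row \<open>i\<close> is unreached there, so they precede \<open>us ! i\<close>. The completed row
  is reached from column \<open>j\<close> onwards by monotonicity; for \<open>j = n\<close> there is
  no such column, hence the guarded premise.\<close>

lemma merged_first:
  assumes M: "merged i j xs" and i: "i < m" and r: "j < n \<Longrightarrow> i * n + j \<in> reached"
  shows "merged (Suc i) j (xs @ [us ! i])"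
proof -
  have I: "{us ! k | k. 0 < k \<and> k < Suc i} = insert (us ! i) {us ! k | k. 0 < k \<and> k < i}"
    using M by (auto simp: merged_def less_Suc_eq)
  have xs: "set xs = insert s ({us ! k | k. 0 < k \<and> k < i} \<union> {vs ! l | l. 0 < l \<and> l < j})"
    using M by (simp add: merged_def)
  have jn: "j \<le> n" using M by (simp add: merged_def)
  have nr: "i * n + j' \<notin> reached" if "0 < j'" "j' < j" for j'
    using M that i by (auto simp: merged_def)
  have "before x (us ! i)" if x: "x \<in> set xs" for x
  proof -
    consider "x = s" | k where "0 < k" "k < i" "x = us ! k" | l where "0 < l" "l < j" "x = vs ! l"
      using x unfolding xs by blast
    then show ?thesis
    proof cases
      case 3
      then show ?thesis using vs_us[of i l] nr[of l] i jn M by (auto simp: merged_def)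
    qed (use before_s before_us i M in \<open>auto simp: merged_def\<close>)
  qed
  moreover have "us ! i \<notin> set xs" unfolding xs using i jn by (auto simp: nth_simps)
  moreover have "i' * n + j' \<in> reached" if "0 < i'" "i' < Suc i" "j \<le> j'" "j' < n" for i' j'
  proof (cases "i' = i")
    case True
    then show ?thesis using reached_mono[of i i j j'] r that i by auto
  next
    case False
    then show ?thesis using M that by (auto simp: merged_def)
  qed
  moreover have "i' * n + j' \<notin> reached" if "0 < j'" "j' < j" "Suc i \<le> i'" "i' < m" for i' j'
    using M that by (auto simp: merged_def)
  ultimately show ?thesis
    using M i unfolding merged_def I by (auto simp: sorted_wrt_append)
qed

text \<open>Dual to \<open>merged_first\<close>: an unreached \<open>(i, j)\<close> makes column
  \<open>j\<close> unreached in all later rows. If \<open>i = m\<close>, no row is left to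
  check.\<close>

lemma merged_second:
  assumes M: "merged i j xs" and j: "j < n" and r: "i * n + j \<notin> reached"
  shows "merged i (Suc j) (xs @ [vs ! j])"
proof -
  have I: "{vs ! l | l. 0 < l \<and> l < Suc j} = insert (vs ! j) {vs ! l | l. 0 < l \<and> l < j}"
    using M by (auto simp: merged_def less_Suc_eq)
  have xs: "set xs = insert s ({us ! k | k. 0 < k \<and> k < i} \<union> {vs ! l | l. 0 < l \<and> l < j})"
    using M by (simp add: merged_def)
  have im: "i \<le> m" using M by (simp add: merged_def)
  have rr: "k * n + j \<in> reached" if "0 < k" "k < i" for k
    using M that j by (auto simp: merged_def)
  have "before x (vs ! j)" if x: "x \<in> set xs" for x
  proof -
    consider "x = s" | k where "0 < k" "k < i" "x = us ! k" | l where "0 < l" "l < j" "x = vs ! l"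
      using x unfolding xs by blast
    then show ?thesis
    proof cases
      case 2
      then show ?thesis using us_vs[of k j] rr[of k] j im M by (auto simp: merged_def)
    qed (use before_s before_vs j M in \<open>auto simp: merged_def\<close>)
  qed
  moreover have "vs ! j \<notin> set xs" unfolding xs using j im by (auto simp: nth_simps)
  moreover have "i' * n + j' \<in> reached" if "0 < i'" "i' < i" "Suc j \<le> j'" "j' < n" for i' j'
    using M that by (auto simp: merged_def)
  moreover have "i' * n + j' \<notin> reached" if "0 < j'" "j' < Suc j" "i \<le> i'" "i' < m" for i' j'
  proof (cases "j' = j")
    case True
    then show ?thesis using reached_mono[of i i' j j] r that j by auto
  next
    case False
    then show ?thesis using M that by (auto simp: merged_def)
  qed
  ultimately show ?thesis
    using M j unfolding merged_def I by (auto simp: sorted_wrt_append)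
qed

lemma merged_end: "merged m n xs \<Longrightarrow> set xs = union_states"
  unfolding merged_def union_states_eq by auto

end

lemma wheeler_pair_exists_pos:
  assumes "distinct us" "distinct vs" "set us \<inter> set vs = {}"
  obtains pos where "\<And>i. i < length us \<Longrightarrow> pos (us ! i) = i * length vs"
    "\<And>j. j < length vs \<Longrightarrow> pos (vs ! j) = j"
proof
  let ?pos = "\<lambda>v. if v \<in> set us then inv_into {..<length us} ((!) us) v * length vs
    else inv_into {..<length vs} ((!) vs) v"
  show "?pos (us ! i) = i * length vs" if "i < length us" for i
    using that assms inv_into_f_f[of "(!) us" "{..<length us}" i] by (simp add: inj_on_nth)
  show "?pos (vs ! j) = j" if "j < length vs" for j
    using that assms inv_into_f_f[of "(!) vs" "{..<length vs}" j]
    by (auto simp: inj_on_nth disjoint_iff)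
qed


section \<open>Total correctness with time bounds\<close>

text \<open>Termination is included, and since runs are deterministic, one run describes the
  behaviour. The postcondition receives the running time, so costs add up through nested
  postconditions.\<close>

definition wp :: "prog \<Rightarrow> (nat \<Rightarrow> config \<Rightarrow> bool) \<Rightarrow> config \<Rightarrow> bool" where
  "wp p Q \<sigma> \<longleftrightarrow> (\<exists>t \<tau>. run p \<sigma> t \<tau> \<and> Q t \<tau>)"

notation Seq (infixr ";;" 60)

lemma wp_mono: "wp p Q \<sigma> \<Longrightarrow> (\<And>t \<tau>. Q t \<tau> \<Longrightarrow> Q' t \<tau>) \<Longrightarrow> wp p Q' \<sigma>"
  by (auto simp: wp_def)

lemma wp_Skip: "wp Skip Q \<sigma> \<longleftrightarrow> Q 1 \<sigma>"
  unfolding wp_def by (metis SkipE run.Skip)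

lemma wp_Assign:
  "wp (Assign x e) Q \<sigma> \<longleftrightarrow> Q (1 + exp_cost e) (\<sigma>\<lparr>regs := (regs \<sigma>)(x := eval e \<sigma>)\<rparr>)"
  unfolding wp_def by (metis AssignE run.Assign)

lemma wp_Store:
  "wp (Store k e f) Q \<sigma> \<longleftrightarrow> Q (1 + exp_cost e + exp_cost f)
    (\<sigma>\<lparr>arrays := (arrays \<sigma>)(k := (arrays \<sigma> k)(eval e \<sigma> := eval f \<sigma>))\<rparr>)"
  unfolding wp_def by (metis StoreE run.Store)

lemma wp_Seq: "wp (p ;; q) Q \<sigma> \<longleftrightarrow> wp p (\<lambda>t \<tau>. wp q (\<lambda>t'. Q (t + t')) \<tau>) \<sigma>"
  unfolding wp_def by (metis SeqE run.Seq)

lemma wp_If: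
  "wp (If c p q) Q \<sigma> \<longleftrightarrow>
     (if holds c \<sigma> then wp p (\<lambda>t. Q (1 + cond_cost c + t)) \<sigma> else wp q (\<lambda>t. Q (1 + cond_cost c + t)) \<sigma>)"
proof (cases "holds c \<sigma>")
  case True
  have "run (If c p q) \<sigma> t \<tau> \<longleftrightarrow> (\<exists>t'. t = 1 + cond_cost c + t' \<and> run p \<sigma> t' \<tau>)" for t \<tau>
    using True run.IfTrue by (auto simp del: One_nat_def elim!: IfE)
  then show ?thesis using True by (auto simp: wp_def)
next
  case False
  have "run (If c p q) \<sigma> t \<tau> \<longleftrightarrow> (\<exists>t'. t = 1 + cond_cost c + t' \<and> run q \<sigma> t' \<tau>)" for t \<tau>
    using False run.IfFalse by (auto simp del: One_nat_def elim!: IfE)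
  then show ?thesis using False by (auto simp: wp_def)
qed

lemmas wp_simps = wp_Skip wp_Assign wp_Store wp_Seq wp_If

text \<open>The potential \<open>\<Phi>\<close> pays for the remaining iterations, hence it bounds the time and ensures termination.\<close>

lemma wp_While:
  assumes "I \<sigma>"
    and step: "\<And>\<tau>. I \<tau> \<Longrightarrow> holds c \<tau> \<Longrightarrow> wp p (\<lambda>t \<rho>. I \<rho> \<and> 1 + cond_cost c + t + \<Phi> \<rho> \<le> \<Phi> \<tau>) \<tau>"
  shows "wp (While c p) (\<lambda>t \<tau>. I \<tau> \<and> \<not> holds c \<tau> \<and> t \<le> \<Phi> \<sigma> + 1 + cond_cost c) \<sigma>"
  using assms(1)
proof (induction "\<Phi> \<sigma>" arbitrary: \<sigma> rule: less_induct)
  case less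
  show ?case
  proof (cases "holds c \<sigma>")
    case False
    then show ?thesis using run.WhileFalse[of c \<sigma> p] less.prems unfolding wp_def by force
  next
    case True
    obtain t \<tau> where t: "run p \<sigma> t \<tau>" "I \<tau>" "1 + cond_cost c + t + \<Phi> \<tau> \<le> \<Phi> \<sigma>"
      using step[OF less.prems True] by (auto simp: wp_def)
    then have "\<Phi> \<tau> < \<Phi> \<sigma>" by simp
    then obtain t' \<rho> where t': "run (While c p) \<tau> t' \<rho>" "I \<rho>" "\<not> holds c \<rho>" "t' \<le> \<Phi> \<tau> + 1 + cond_cost c"
      using less.hyps[OF _ t(2)] by (auto simp: wp_def)
    show ?thesis unfolding wp_def
      using run.WhileTrue[OF True t(1) t'(1)] t(3) t' by (intro exI conjI) auto
  qed
qed

definition For :: "nat \<Rightarrow> nat \<Rightarrow> prog \<Rightarrow> prog" where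
  "For x y p = Assign x (Const 0) ;; While (Less (Reg x) (Reg y)) (p ;; Assign x (Plus (Reg x) (Const 1)))"

text \<open>The 8 is the cost of one loop test and one increment, 4 each; the 6 is 2 for the
  initialization and 4 for the last test. The invariant is required after the increment, so the body
  may not alter the counter.\<close>

lemma wp_For:
  assumes init: "I 0 (\<sigma>\<lparr>regs := (regs \<sigma>)(x := 0)\<rparr>)"
    and I: "\<And>k \<tau>. I k \<tau> \<Longrightarrow> regs \<tau> x = k \<and> regs \<tau> y = n"
    and step: "\<And>k \<tau>. k < n \<Longrightarrow> I k \<tau> \<Longrightarrow>
      wp p (\<lambda>t \<rho>. t \<le> c \<and> regs \<rho> x = k \<and> I (Suc k) (\<rho>\<lparr>regs := (regs \<rho>)(x := Suc k)\<rparr>)) \<tau>"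
  shows "wp (For x y p) (\<lambda>t \<tau>. I n \<tau> \<and> t \<le> n * (c + 8) + 6) \<sigma>"
proof -
  define J where "J = (\<lambda>\<tau>. \<exists>k\<le>n. I k \<tau>)"
  define \<Phi> where "\<Phi> = (\<lambda>\<tau> :: config. (n - regs \<tau> x) * (c + 8))"
  let ?\<sigma> = "\<sigma>\<lparr>regs := (regs \<sigma>)(x := 0)\<rparr>"
  let ?b = "Less (Reg x) (Reg y)"
  have "wp (While ?b (p ;; Assign x (Plus (Reg x) (Const 1))))
      (\<lambda>t \<tau>. J \<tau> \<and> \<not> holds ?b \<tau> \<and> t \<le> \<Phi> ?\<sigma> + 1 + cond_cost ?b) ?\<sigma>"
  proof (rule wp_While)
    show "J ?\<sigma>" using init by (auto simp: J_def)
  next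
    fix \<tau> assume "J \<tau>" and b: "holds ?b \<tau>"
    then obtain k where k: "I k \<tau>" "k < n" using I by (force simp: J_def)
    have nk: "n - k = Suc (n - Suc k)" using k by simp
    show "wp (p ;; Assign x (Plus (Reg x) (Const 1)))
        (\<lambda>t \<rho>. J \<rho> \<and> 1 + cond_cost ?b + t + \<Phi> \<rho> \<le> \<Phi> \<tau>) \<tau>"
      unfolding wp_Seq
    proof (rule wp_mono[OF step[OF k(2,1)]], elim conjE)
      fix t \<rho> assume h: "t \<le> c" "regs \<rho> x = k" "I (Suc k) (\<rho>\<lparr>regs := (regs \<rho>)(x := Suc k)\<rparr>)"
      have "J (\<rho>\<lparr>regs := (regs \<rho>)(x := Suc k)\<rparr>)" using h(3) k(2) unfolding J_def by (meson Suc_leI)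
      moreover have "1 + cond_cost ?b + (t + 4) + \<Phi> (\<rho>\<lparr>regs := (regs \<rho>)(x := Suc k)\<rparr>) \<le> \<Phi> \<tau>"
        using h I[OF k(1)] by (simp add: \<Phi>_def nk)
      ultimately show "wp (Assign x (Plus (Reg x) (Const 1)))
          (\<lambda>t' \<rho>. J \<rho> \<and> 1 + cond_cost ?b + (t + t') + \<Phi> \<rho> \<le> \<Phi> \<tau>) \<rho>"
        using h by (simp add: wp_Assign)
    qed
  qed
  then show ?thesis
    unfolding For_def wp_Seq wp_Assign eval.simps exp_cost.simps
  proof (rule wp_mono, elim conjE)
    fix t \<tau> assume h: "J \<tau>" "\<not> holds ?b \<tau>" "t \<le> \<Phi> ?\<sigma> + 1 + cond_cost ?b"
    then obtain k where k: "k \<le> n" "I k \<tau>" by (auto simp: J_def)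
    then have "k = n" using h(2) I[OF k(2)] by simp
    then show "I n \<tau> \<and> 1 + 1 + t \<le> n * (c + 8) + 6" using k h(3) by (simp add: \<Phi>_def)
  qed
qed

text \<open>Both branches become one state with a conditional value and a common time bound, so
  consecutive conditional assignments do not double the number of cases.\<close>

lemma wp_If_Assign:
  assumes "\<And>t. t \<le> 2 + cond_cost c + exp_cost e \<Longrightarrow>
    Q t (\<sigma>\<lparr>regs := (regs \<sigma>)(x := if holds c \<sigma> then eval e \<sigma> else regs \<sigma> x)\<rparr>)"
  shows "wp (If c (Assign x e) Skip) Q \<sigma>"
  using assms[of "2 + cond_cost c + exp_cost e"] assms[of "2 + cond_cost c"]
  by (simp add: wp_simps split: if_splits)

text \<open>A frame condition: it carries facts about input and earlier results across a phase that
  touches only \<open>R\<close> and \<open>A\<close>.\<close>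

definition agree :: "nat set \<Rightarrow> nat set \<Rightarrow> config \<Rightarrow> config \<Rightarrow> bool" where
  "agree R A \<sigma> \<tau> \<longleftrightarrow> (\<forall>x. x \<notin> R \<longrightarrow> regs \<tau> x = regs \<sigma> x) \<and> (\<forall>k. k \<notin> A \<longrightarrow> arrays \<tau> k = arrays \<sigma> k)"

lemma agree_refl: "agree R A \<sigma> \<sigma>"
  by (simp add: agree_def)

lemma agree_trans:
  "agree R A \<sigma> \<tau> \<Longrightarrow> agree R' A' \<tau> \<rho> \<Longrightarrow> R \<union> R' \<subseteq> R'' \<Longrightarrow> A \<union> A' \<subseteq> A'' \<Longrightarrow> agree R'' A'' \<sigma> \<rho>"
  unfolding agree_def by (metis UnCI subset_iff)

lemma agree_regs: "agree R A \<sigma> \<tau> \<Longrightarrow> x \<in> R \<Longrightarrow> agree R A \<sigma> (\<tau>\<lparr>regs := (regs \<tau>)(x := v)\<rparr>)"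
  by (auto simp: agree_def)

lemma agree_weaken: "agree R A \<sigma> \<tau> \<Longrightarrow> R \<subseteq> R' \<Longrightarrow> A \<subseteq> A' \<Longrightarrow> agree R' A' \<sigma> \<tau>"
  by (auto simp: agree_def)


section \<open>Graphs as linked adjacency lists\<close>

text \<open>Edges are numbered from 1, so that 0 can serve as the null pointer.\<close>

fun previous :: "(nat \<Rightarrow> nat) \<Rightarrow> nat \<Rightarrow> nat \<Rightarrow> nat" where
  "previous f 0 a = 0"
| "previous f (Suc k) a = (if k \<noteq> 0 \<and> f k = a then k else previous f k a)"

lemma previous_cong: "(\<And>q. q < k \<Longrightarrow> f q = g q) \<Longrightarrow> previous f k a = previous g k a"
  by (induction k) auto

lemma previous_less: "previous f k a \<noteq> 0 \<Longrightarrow> previous f k a < k \<and> f (previous f k a) = a"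
  by (induction k) (auto split: if_splits)

text \<open>With \<open>previous_less\<close>, this identifies \<open>previous f k a\<close> as the
  largest edge number below \<open>k\<close> with source \<open>a\<close>, or 0 if there is
  none.\<close>

lemma previous_gap: "previous f k a < q \<Longrightarrow> q < k \<Longrightarrow> f q \<noteq> a"
proof (induction k)
  case (Suc k)
  then show ?case by (cases "q = k") (auto split: if_splits)
qed simp

text \<open>\<open>f\<close> gives the source of each edge; it is not stored but exists for the
  specification only. New edges are put in front, so a list runs through decreasing numbers. A pair
  may occur under several numbers, and time is charged per number.\<close>

definition adjacency_lists ::
    "nat rel \<Rightarrow> (nat \<Rightarrow> nat) \<Rightarrow> nat \<Rightarrow> (nat \<Rightarrow> nat) \<Rightarrow> (nat \<Rightarrow> nat) \<Rightarrow> (nat \<Rightarrow> nat) \<Rightarrow> bool" where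
  "adjacency_lists G f k head tg nx \<longleftrightarrow>
     0 < k \<and> G = {(f e, tg e) | e. 0 < e \<and> e < k} \<and> (\<forall>x. head x = previous f k x) \<and>
     (\<forall>e. 0 < e \<and> e < k \<longrightarrow> nx e = previous f e (f e))"

definition represents :: "config \<Rightarrow> nat rel \<Rightarrow> bool" where
  "represents \<sigma> G \<longleftrightarrow> (\<exists>f. adjacency_lists G f (regs \<sigma> 12) (arrays \<sigma> 12) (arrays \<sigma> 13) (arrays \<sigma> 14))"

lemma represents_empty:
  assumes "regs \<sigma> 12 = 1" "arrays \<sigma> 12 = (\<lambda>_. 0)"
  shows "represents \<sigma> {}"
  unfolding represents_def adjacency_lists_def using assms by (intro exI[of _ "\<lambda>_. 0"]) auto

lemma represents_regs:
  "x \<noteq> 12 \<Longrightarrow> represents (\<tau>\<lparr>regs := (regs \<tau>)(x := v)\<rparr>) G \<longleftrightarrow> represents \<tau> G"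
  by (simp add: represents_def)

definition add_edge :: "nat \<Rightarrow> nat \<Rightarrow> prog" where
  "add_edge x y =
     Store 13 (Reg 12) (Reg y) ;;
     Store 14 (Reg 12) (Cell 12 (Reg x)) ;;
     Store 12 (Reg x) (Reg 12) ;;
     Assign 12 (Plus (Reg 12) (Const 1))"

lemma adjacency_lists_insert:
  assumes "adjacency_lists G f k head tg nx"
  shows "adjacency_lists (insert (a, b) G) (f(k := a)) (Suc k) (head(a := k)) (tg(k := b)) (nx(k := head a))"
proof -
  \<comment> \<open>\<open>previous\<close> at \<open>e\<close> looks only at numbers below
    \<open>e\<close>, so the new edge \<open>k\<close> leaves all existing links valid.\<close>
  have p: "previous (f(k := a)) e x = previous f e x" if "e \<le> k" for e x
    using that by (intro previous_cong) auto
  have "insert (a, b) G = {((f(k := a)) e, (tg(k := b)) e) | e. 0 < e \<and> e < Suc k}" (is "_ = ?R")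
  proof -
    have "?R = {((f(k := a)) e, (tg(k := b)) e) | e. 0 < e \<and> e < k \<or> e = k}"
      using assms by (auto simp: adjacency_lists_def less_Suc_eq)
    also have "\<dots> = insert (a, b) {(f e, tg e) | e. 0 < e \<and> e < k}"
      by (force)
    finally show ?thesis using assms by (simp add: adjacency_lists_def)
  qed
  then show ?thesis
    using assms p[of k] p by (auto simp: adjacency_lists_def less_Suc_eq)
qed

lemma wp_add_edge:
  assumes "represents \<sigma> G"
    and "\<And>\<tau>. represents \<tau> (insert (regs \<sigma> x, regs \<sigma> y) G) \<Longrightarrow> agree {12} {12, 13, 14} \<sigma> \<tau> \<Longrightarrow>
      regs \<tau> 12 = Suc (regs \<sigma> 12) \<Longrightarrow> Q 14 \<tau>"
  shows "wp (add_edge x y) Q \<sigma>"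
proof -
  obtain f where f: "adjacency_lists G f (regs \<sigma> 12) (arrays \<sigma> 12) (arrays \<sigma> 13) (arrays \<sigma> 14)"
    using assms(1) by (auto simp: represents_def)
  define \<tau> where "\<tau> = \<sigma>\<lparr>arrays := (arrays \<sigma>)(13 := (arrays \<sigma> 13)(regs \<sigma> 12 := regs \<sigma> y),
      14 := (arrays \<sigma> 14)(regs \<sigma> 12 := arrays \<sigma> 12 (regs \<sigma> x)),
      12 := (arrays \<sigma> 12)(regs \<sigma> x := regs \<sigma> 12)),
    regs := (regs \<sigma>)(12 := Suc (regs \<sigma> 12))\<rparr>"
  have "represents \<tau> (insert (regs \<sigma> x, regs \<sigma> y) G)"
    using adjacency_lists_insert[OF f, of "regs \<sigma> x" "regs \<sigma> y"] by (auto simp: represents_def \<tau>_def)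
  then have "Q 14 \<tau>" by (rule assms(2)) (auto simp: agree_def \<tau>_def)
  then show ?thesis by (simp add: add_edge_def wp_simps \<tau>_def numeral_eq_Suc)
qed


section \<open>Graph search\<close>

definition visit_edge :: prog where
  "visit_edge =
     Assign 14 (Cell 13 (Reg 17)) ;;
     If (Equal (Cell 15 (Reg 14)) (Const 0))
       (Store 15 (Reg 14) (Const 1) ;; Store 16 (Reg 16) (Reg 14) ;; Assign 16 (Plus (Reg 16) (Const 1)))
       Skip ;;
     Assign 17 (Cell 14 (Reg 17))"

definition search :: prog where
  "search =
     Store 15 (Const 0) (Const 1) ;; Store 16 (Const 0) (Const 0) ;;
     Assign 15 (Const 0) ;; Assign 16 (Const 1) ;;
     While (Less (Reg 15) (Reg 16))
       (Assign 17 (Cell 12 (Cell 16 (Reg 15))) ;;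
        While (Less (Const 0) (Reg 17)) visit_edge ;;
        Assign 15 (Plus (Reg 15) (Const 1)))"

lemma wp_visit_edge:
  assumes "\<And>t \<rho>. agree {14, 16, 17} {15, 16} \<tau> \<rho> \<Longrightarrow> regs \<rho> 17 = arrays \<tau> 14 (regs \<tau> 17) \<Longrightarrow> t \<le> 26 \<Longrightarrow>
    (if arrays \<tau> 15 (arrays \<tau> 13 (regs \<tau> 17)) = 0
     then arrays \<rho> 15 = (arrays \<tau> 15)(arrays \<tau> 13 (regs \<tau> 17) := 1) \<and>
       arrays \<rho> 16 = (arrays \<tau> 16)(regs \<tau> 16 := arrays \<tau> 13 (regs \<tau> 17)) \<and> regs \<rho> 16 = Suc (regs \<tau> 16)
     else arrays \<rho> 15 = arrays \<tau> 15 \<and> arrays \<rho> 16 = arrays \<tau> 16 \<and> regs \<rho> 16 = regs \<tau> 16) \<Longrightarrow> Q t \<rho>"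
  shows "wp visit_edge Q \<tau>"
  by (auto simp: visit_edge_def wp_simps agree_def intro!: assms)

text \<open>\<open>q\<close> restricted to \<open>{..<t}\<close> is everything ever enqueued,
  processed entries included, and coincides with the marked nodes. Injectivity serves the time
  bound: at most \<open>N + 1\<close> entries, and no node is expanded twice.\<close>

definition queue_inv :: "nat rel \<Rightarrow> nat \<Rightarrow> (nat \<Rightarrow> nat) \<Rightarrow> (nat \<Rightarrow> nat) \<Rightarrow> nat \<Rightarrow> bool" where
  "queue_inv G N v q t \<longleftrightarrow> inj_on q {..<t} \<and> (\<forall>y. v y \<noteq> 0 \<longleftrightarrow> y \<in> q ` {..<t}) \<and>
     q ` {..<t} \<subseteq> G\<^sup>* `` {0} \<inter> {..N} \<and> 0 \<in> q ` {..<t}"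

lemma queue_inv_add:
  assumes "queue_inv G N v q t" "v y = 0" "y \<le> N" "(0, y) \<in> G\<^sup>*"
  shows "queue_inv G N (v(y := 1)) (q(t := y)) (Suc t)"
proof -
  have "(q(t := y)) ` {..<Suc t} = insert y (q ` {..<t})"
    by (auto simp: lessThan_Suc)
  moreover have "y \<notin> q ` {..<t}"
    using assms(1) \<open>v y = 0\<close> unfolding queue_inv_def by blast
  moreover have "inj_on (q(t := y)) {..<Suc t}"
    using assms(1) calculation(2)
    by (auto simp: lessThan_Suc queue_inv_def inj_on_def)
  ultimately show ?thesis using assms by (auto simp: queue_inv_def)
qed

lemma queue_inv_length: "queue_inv G N v q t \<Longrightarrow> t \<le> Suc N"
  using card_mono[of "{..N}" "q ` {..<t}"] by (auto simp: queue_inv_def card_image)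

text \<open>When every entry has been expanded, the marked set contains 0 and is closed under
  \<open>G\<close>, hence contains all reachable nodes; the converse is part of the
  invariant.\<close>

lemma queue_inv_closed:
  assumes q: "queue_inv G N v q t" and c: "\<And>i y. i < t \<Longrightarrow> (q i, y) \<in> G \<Longrightarrow> v y \<noteq> 0"
  shows "v y \<noteq> 0 \<longleftrightarrow> (0, y) \<in> G\<^sup>*"
proof
  assume "(0, y) \<in> G\<^sup>*"
  then show "v y \<noteq> 0"
  proof (induction rule: rtrancl_induct)
    case base
    then show ?case using q by (auto simp: queue_inv_def)
  next
    case (step y z)
    then obtain i where "i < t" "y = q i" using q by (auto simp: queue_inv_def)
    then show ?case using c step by blast
  qed
qed (use q in \<open>auto simp: queue_inv_def\<close>)

text \<open>Edge numbers decrease along a list, so the edges still to be visited are those with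
  source \<open>x\<close> numbered up to the pointer; their number is the potential of the inner
  loop.\<close>

lemma previous_edges:
  assumes "p = previous f k x"
  shows "{e. 0 < e \<and> e < k \<and> f e = x} = {e. 0 < e \<and> e \<le> p \<and> f e = x}"
  using assms previous_less[of f k x] previous_gap[of f k x]
  by (auto simp: not_less[symmetric])

context
  fixes G f k head tg nx N
  assumes al: "adjacency_lists G f k head tg nx" and bounded: "G \<subseteq> {..N} \<times> {..N}"
begin

lemma edge_in_graph: "0 < e \<Longrightarrow> e < k \<Longrightarrow> (f e, tg e) \<in> G"
  using al by (auto simp: adjacency_lists_def)

text \<open>\<open>\<sigma>\<close> is the state on entry. Marks and queue entries present there
  survive, and once the pointer in register 17 is 0, the last conjunct says that all successors of
  \<open>x\<close> are marked.\<close>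

definition edge_loop_inv :: "nat \<Rightarrow> config \<Rightarrow> config \<Rightarrow> bool" where
  "edge_loop_inv x \<sigma> \<tau> \<longleftrightarrow> agree {14, 16, 17} {15, 16} \<sigma> \<tau> \<and>
     queue_inv G N (arrays \<tau> 15) (arrays \<tau> 16) (regs \<tau> 16) \<and> regs \<sigma> 16 \<le> regs \<tau> 16 \<and>
     (\<forall>i<regs \<sigma> 16. arrays \<tau> 16 i = arrays \<sigma> 16 i) \<and> (\<forall>y. arrays \<sigma> 15 y \<noteq> 0 \<longrightarrow> arrays \<tau> 15 y \<noteq> 0) \<and>
     (regs \<tau> 17 \<noteq> 0 \<longrightarrow> regs \<tau> 17 < k \<and> f (regs \<tau> 17) = x) \<and>
     (\<forall>e. regs \<tau> 17 < e \<and> e < k \<and> f e = x \<longrightarrow> arrays \<tau> 15 (tg e) \<noteq> 0)"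

text \<open>Each edge is charged 30: 26 bounds the body and 4 is the loop test.\<close>

lemma edge_loop_step:
  assumes arr: "arrays \<sigma> 13 = tg" "arrays \<sigma> 14 = nx" and x: "(0, x) \<in> G\<^sup>*"
    and J: "edge_loop_inv x \<sigma> \<tau>" and p: "0 < regs \<tau> 17"
  shows "wp visit_edge (\<lambda>t \<rho>. edge_loop_inv x \<sigma> \<rho> \<and>
    4 + t + 30 * card {e. 0 < e \<and> e \<le> regs \<rho> 17 \<and> f e = x} \<le> 30 * card {e. 0 < e \<and> e \<le> regs \<tau> 17 \<and> f e = x}) \<tau>"
proof -
  let ?p = "regs \<tau> 17"
  have pk: "?p < k" "f ?p = x" using J p by (auto simp: edge_loop_inv_def)
  have arr': "arrays \<tau> 13 = tg" "arrays \<tau> 14 = nx" using J arr by (auto simp: edge_loop_inv_def agree_def)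
  have nx: "nx ?p = previous f ?p x" using al pk p by (simp add: adjacency_lists_def)
  have pe: "{e. 0 < e \<and> e < ?p \<and> f e = x} = {e. 0 < e \<and> e \<le> nx ?p \<and> f e = x}"
    by (rule previous_edges[OF nx])
  have "{e. 0 < e \<and> e \<le> ?p \<and> f e = x} = insert ?p {e. 0 < e \<and> e < ?p \<and> f e = x}"
    using pk p by auto
  then have card: "card {e. 0 < e \<and> e \<le> ?p \<and> f e = x} = Suc (card {e. 0 < e \<and> e \<le> nx ?p \<and> f e = x})"
    unfolding pe by (simp add: pe[symmetric])
  \<comment> \<open>No edge with source \<open>x\<close> lies strictly between the next pointer and
    the current one, so moving the pointer adds only the current edge to those whose targets must be
    marked.\<close>
  have gap: "tg e = tg ?p \<or> arrays \<tau> 15 (tg e) \<noteq> 0" if "nx ?p < e" "e < k" "f e = x" for e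
  proof -
    have "\<not> e < ?p" using that previous_gap[of f ?p x e] nx by auto
    then consider "e = ?p" | "?p < e" by linarith
    then show ?thesis using that J unfolding edge_loop_inv_def by cases blast+
  qed
  have nxp: "nx ?p \<noteq> 0 \<longrightarrow> nx ?p < k \<and> f (nx ?p) = x"
    using previous_less[of f ?p x] nx pk by auto
  have "(x, tg ?p) \<in> G" using edge_in_graph[of ?p] p pk by simp
  then have tgp: "(0, tg ?p) \<in> G\<^sup>*" "tg ?p \<le> N" using x bounded by auto
  have q: "queue_inv G N (arrays \<tau> 15) (arrays \<tau> 16) (regs \<tau> 16)"
    using J by (simp add: edge_loop_inv_def)
  note q' = queue_inv_add[OF q _ tgp(2,1)]
  show ?thesis
  proof (rule wp_visit_edge)
    fix t :: nat and \<rho>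
    assume ag: "agree {14, 16, 17} {15, 16} \<tau> \<rho>" and p': "regs \<rho> 17 = arrays \<tau> 14 ?p" and t: "t \<le> 26"
      and v: "if arrays \<tau> 15 (arrays \<tau> 13 ?p) = 0
        then arrays \<rho> 15 = (arrays \<tau> 15)(arrays \<tau> 13 ?p := 1) \<and>
          arrays \<rho> 16 = (arrays \<tau> 16)(regs \<tau> 16 := arrays \<tau> 13 ?p) \<and> regs \<rho> 16 = Suc (regs \<tau> 16)
        else arrays \<rho> 15 = arrays \<tau> 15 \<and> arrays \<rho> 16 = arrays \<tau> 16 \<and> regs \<rho> 16 = regs \<tau> 16"
    have "agree {14, 16, 17} {15, 16} \<sigma> \<rho>" using J ag by (simp add: edge_loop_inv_def agree_def)
    moreover have "queue_inv G N (arrays \<rho> 15) (arrays \<rho> 16) (regs \<rho> 16)"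
      using v q q' arr' by (auto split: if_splits)
    moreover have "regs \<tau> 16 \<le> regs \<rho> 16" "\<forall>i<regs \<tau> 16. arrays \<rho> 16 i = arrays \<tau> 16 i"
      "\<forall>y. arrays \<tau> 15 y \<noteq> 0 \<longrightarrow> arrays \<rho> 15 y \<noteq> 0" and tg: "arrays \<rho> 15 (tg ?p) \<noteq> 0"
      using v arr' by (auto split: if_splits)
    ultimately have "edge_loop_inv x \<sigma> \<rho>"
      using J p' arr' nxp gap unfolding edge_loop_inv_def
      by (intro conjI allI impI) (simp_all, metis+)
    then show "edge_loop_inv x \<sigma> \<rho> \<and>
      4 + t + 30 * card {e. 0 < e \<and> e \<le> regs \<rho> 17 \<and> f e = x} \<le> 30 * card {e. 0 < e \<and> e \<le> ?p \<and> f e = x}"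
      using card p' arr' t by simp
  qed
qed

lemma wp_edge_loop:
  assumes arr: "arrays \<sigma> 13 = tg" "arrays \<sigma> 14 = nx" and x: "(0, x) \<in> G\<^sup>*"
    and q: "queue_inv G N (arrays \<sigma> 15) (arrays \<sigma> 16) (regs \<sigma> 16)" and p: "regs \<sigma> 17 = previous f k x"
  shows "wp (While (Less (Const 0) (Reg 17)) visit_edge) (\<lambda>t \<tau>. edge_loop_inv x \<sigma> \<tau> \<and> regs \<tau> 17 = 0 \<and>
    t \<le> 30 * card {e. 0 < e \<and> e < k \<and> f e = x} + 4) \<sigma>"
proof (rule wp_mono)
  show "wp (While (Less (Const 0) (Reg 17)) visit_edge) (\<lambda>t \<tau>. edge_loop_inv x \<sigma> \<tau> \<and>
      \<not> holds (Less (Const 0) (Reg 17)) \<tau> \<and>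
      t \<le> 30 * card {e. 0 < e \<and> e \<le> regs \<sigma> 17 \<and> f e = x} + 1 + cond_cost (Less (Const 0) (Reg 17))) \<sigma>"
  proof (rule wp_While)
    show "edge_loop_inv x \<sigma> \<sigma>"
      using q p previous_less[of f k x] previous_gap[of f k x]
      by (auto simp: edge_loop_inv_def agree_def)
  next
    fix \<tau> assume "edge_loop_inv x \<sigma> \<tau>" "holds (Less (Const 0) (Reg 17)) \<tau>"
    then show "wp visit_edge (\<lambda>t \<rho>. edge_loop_inv x \<sigma> \<rho> \<and> 1 + cond_cost (Less (Const 0) (Reg 17)) + t +
        30 * card {e. 0 < e \<and> e \<le> regs \<rho> 17 \<and> f e = x} \<le> 30 * card {e. 0 < e \<and> e \<le> regs \<tau> 17 \<and> f e = x}) \<tau>"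
      by (intro wp_mono[OF edge_loop_step[OF arr x]]) simp_all
  qed
qed (simp add: previous_edges[OF p])

definition search_inv :: "config \<Rightarrow> config \<Rightarrow> bool" where
  "search_inv \<sigma> \<tau> \<longleftrightarrow> agree {14, 15, 16, 17} {15, 16} \<sigma> \<tau> \<and>
     queue_inv G N (arrays \<tau> 15) (arrays \<tau> 16) (regs \<tau> 16) \<and> regs \<tau> 15 \<le> regs \<tau> 16 \<and>
     (\<forall>i<regs \<tau> 15. \<forall>y. (arrays \<tau> 16 i, y) \<in> G \<longrightarrow> arrays \<tau> 15 y \<noteq> 0)"

text \<open>Amortization: 30 for each queue position still available, plus 30 for each edge whose
  source has not been expanded. Expanding \<open>x\<close> releases exactly the edges leaving
  \<open>x\<close>, which pays for the inner loop.\<close>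

definition search_potential :: "config \<Rightarrow> nat" where
  "search_potential \<tau> = 30 * (Suc N - regs \<tau> 15) +
     30 * card {e. 0 < e \<and> e < k \<and> f e \<notin> arrays \<tau> 16 ` {..<regs \<tau> 15}}"

lemma search_step:
  assumes arr: "arrays \<sigma> 12 = head" "arrays \<sigma> 13 = tg" "arrays \<sigma> 14 = nx"
    and I: "search_inv \<sigma> \<tau>" and lt: "regs \<tau> 15 < regs \<tau> 16"
  shows "wp (Assign 17 (Cell 12 (Cell 16 (Reg 15))) ;; While (Less (Const 0) (Reg 17)) visit_edge ;;
       Assign 15 (Plus (Reg 15) (Const 1)))
     (\<lambda>t \<rho>. search_inv \<sigma> \<rho> \<and> 4 + t + search_potential \<rho> \<le> search_potential \<tau>) \<tau>"
proof -
  define h where "h = regs \<tau> 15"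
  define x where "x = arrays \<tau> 16 h"
  define \<tau>' where "\<tau>' = \<tau>\<lparr>regs := (regs \<tau>)(17 := head x)\<rparr>"
  have arr': "arrays \<tau> 12 = head" "arrays \<tau> 13 = tg" "arrays \<tau> 14 = nx"
    using I arr by (auto simp: search_inv_def agree_def)
  have q: "queue_inv G N (arrays \<tau> 15) (arrays \<tau> 16) (regs \<tau> 16)" using I by (simp add: search_inv_def)
  have xr: "(0, x) \<in> G\<^sup>*" using q lt by (auto simp: queue_inv_def x_def h_def)
  have hdx: "head x = previous f k x" using al by (simp add: adjacency_lists_def)
  have hN: "h < Suc N" using queue_inv_length[OF q] lt by (simp add: h_def)
  have loop: "wp (While (Less (Const 0) (Reg 17)) visit_edge) (\<lambda>t \<rho>. edge_loop_inv x \<tau>' \<rho> \<and> regs \<rho> 17 = 0 \<and>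
    t \<le> 30 * card {e. 0 < e \<and> e < k \<and> f e = x} + 4) \<tau>'"
    by (rule wp_edge_loop) (use arr' q xr hdx in \<open>simp_all add: \<tau>'_def\<close>)
  have inj: "inj_on (arrays \<tau> 16) {..<regs \<tau> 16}" using q by (simp add: queue_inv_def)
  \<comment> \<open>By injectivity of the queue, \<open>x\<close> was not expanded before, so its
    edges are still contained in the potential.\<close>
  have xnot: "x \<notin> arrays \<tau> 16 ` {..<h}"
    using inj_onD[OF inj, of h] lt by (fastforce simp: x_def h_def)
  define S where "S = arrays \<tau> 16 ` {..<h}"
  have img: "arrays \<tau> 16 ` {..<Suc h} = insert x S" by (auto simp: lessThan_Suc x_def S_def)
  have "{e. 0 < e \<and> e < k \<and> f e \<notin> S} =
      {e. 0 < e \<and> e < k \<and> f e \<notin> insert x S} \<union> {e. 0 < e \<and> e < k \<and> f e = x}"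
    using xnot unfolding S_def[symmetric] by blast
  then have card: "card {e. 0 < e \<and> e < k \<and> f e \<notin> S} =
      card {e. 0 < e \<and> e < k \<and> f e \<notin> insert x S} + card {e. 0 < e \<and> e < k \<and> f e = x}"
    by (simp, intro card_Un_disjoint) auto
  show ?thesis
  proof (simp only: wp_Seq wp_Assign eval.simps arr' h_def[symmetric] x_def[symmetric] \<tau>'_def[symmetric],
      rule wp_mono[OF loop], elim conjE)
    fix t \<rho>
    assume J: "edge_loop_inv x \<tau>' \<rho>" and p0: "regs \<rho> 17 = 0"
      and t: "t \<le> 30 * card {e. 0 < e \<and> e < k \<and> f e = x} + 4"
    let ?\<rho> = "\<rho>\<lparr>regs := (regs \<rho>)(15 := Suc h)\<rparr>"
    have h\<rho>: "regs \<rho> 15 = h" using J by (simp add: edge_loop_inv_def agree_def \<tau>'_def h_def)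
    have same: "arrays \<rho> 16 i = arrays \<tau> 16 i" if "i \<le> h" for i
      using J that lt by (simp add: edge_loop_inv_def \<tau>'_def h_def)
    then have img\<rho>: "arrays \<rho> 16 ` {..<Suc h} = insert x S"
      unfolding img[symmetric] by (intro image_cong) auto
    have exp: "arrays \<rho> 15 y \<noteq> 0" if "i < Suc h" "(arrays \<rho> 16 i, y) \<in> G" for i y
    proof (cases "i = h")
      case True
      then have "(x, y) \<in> G" using that same[of h] by (simp add: x_def)
      then obtain e where "0 < e" "e < k" "f e = x" "tg e = y" using al by (auto simp: adjacency_lists_def)
      then show ?thesis using J p0 by (auto simp: edge_loop_inv_def)
    next
      case False
      then have "i < h" using that by simp
      then have "arrays \<tau> 15 y \<noteq> 0" using I that same[of i] unfolding search_inv_def h_def by simp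
      then show ?thesis using J by (auto simp: edge_loop_inv_def \<tau>'_def)
    qed
    have "agree {14, 15, 16, 17} {15, 16} \<sigma> ?\<rho>"
      using J I by (auto simp: edge_loop_inv_def search_inv_def agree_def \<tau>'_def)
    moreover have "Suc h \<le> regs \<rho> 16" using J lt by (auto simp: edge_loop_inv_def \<tau>'_def h_def)
    ultimately have "search_inv \<sigma> ?\<rho>"
      using J exp by (auto simp: edge_loop_inv_def search_inv_def)
    moreover have "4 + (5 + (t + 4)) + search_potential ?\<rho> \<le> search_potential \<tau>"
    proof -
      have "Suc N - h = Suc (Suc N - Suc h)" using hN by simp
      then show ?thesis using t card by (simp add: search_potential_def img\<rho> h_def[symmetric] S_def[symmetric])
    qed
    ultimately show "search_inv \<sigma> (\<rho>\<lparr>regs := (regs \<rho>)(15 := regs \<rho> 15 + 1)\<rparr>) \<and>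
        4 + (1 + exp_cost (Cell 12 (Cell 16 (Reg 15))) + (t + (1 + exp_cost (Plus (Reg 15) (Const 1))))) +
        search_potential (\<rho>\<lparr>regs := (regs \<rho>)(15 := regs \<rho> 15 + 1)\<rparr>) \<le> search_potential \<tau>"
      by (simp add: h\<rho>)
  qed
qed

lemma wp_search_adjacency:
  assumes arr: "arrays \<sigma> 12 = head" "arrays \<sigma> 13 = tg" "arrays \<sigma> 14 = nx" and z: "arrays \<sigma> 15 = (\<lambda>_. 0)"
  shows "wp search (\<lambda>t \<tau>. agree {14, 15, 16, 17} {15, 16} \<sigma> \<tau> \<and>
    (\<forall>y. arrays \<tau> 15 y \<noteq> 0 \<longleftrightarrow> (0, y) \<in> G\<^sup>*) \<and> t \<le> 30 * Suc N + 30 * k + 20) \<sigma>"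
proof -
  define \<sigma>' where "\<sigma>' = \<sigma>\<lparr>arrays := (arrays \<sigma>)(15 := (\<lambda>_. 0)(0 := 1), 16 := (arrays \<sigma> 16)(0 := 0)),
    regs := (regs \<sigma>)(15 := 0, 16 := 1)\<rparr>"
  let ?c = "Less (Reg 15) (Reg 16)"
  have "card {e. 0 < e \<and> e < k \<and> f e \<notin> arrays \<sigma>' 16 ` {..<regs \<sigma>' 15}} \<le> card {..<k}"
    by (intro card_mono) auto
  then have pot: "search_potential \<sigma>' \<le> 30 * Suc N + 30 * k"
    by (simp add: search_potential_def)
  have arr\<sigma>': "arrays \<sigma>' 12 = head" "arrays \<sigma>' 13 = tg" "arrays \<sigma>' 14 = nx" using arr by (simp_all add: \<sigma>'_def)
  have loop: "wp (While ?c
      (Assign 17 (Cell 12 (Cell 16 (Reg 15))) ;; While (Less (Const 0) (Reg 17)) visit_edge ;;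
       Assign 15 (Plus (Reg 15) (Const 1))))
     (\<lambda>t \<tau>. search_inv \<sigma>' \<tau> \<and> \<not> holds ?c \<tau> \<and> t \<le> search_potential \<sigma>' + 1 + cond_cost ?c) \<sigma>'"
  proof (rule wp_While)
    show "search_inv \<sigma>' \<sigma>'"
      by (auto simp: search_inv_def agree_def queue_inv_def lessThan_Suc \<sigma>'_def)
  next
    fix \<tau> assume "search_inv \<sigma>' \<tau>" "holds ?c \<tau>"
    then show "wp (Assign 17 (Cell 12 (Cell 16 (Reg 15))) ;; While (Less (Const 0) (Reg 17)) visit_edge ;;
       Assign 15 (Plus (Reg 15) (Const 1)))
     (\<lambda>t \<rho>. search_inv \<sigma>' \<rho> \<and> 1 + cond_cost ?c + t + search_potential \<rho> \<le> search_potential \<tau>) \<tau>"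
      by (intro wp_mono[OF search_step[OF arr\<sigma>']]) simp_all
  qed
  have fin: "agree {14, 15, 16, 17} {15, 16} \<sigma> \<tau> \<and>
    (\<forall>y. arrays \<tau> 15 y \<noteq> 0 \<longleftrightarrow> (0, y) \<in> G\<^sup>*)" if "search_inv \<sigma>' \<tau>" "\<not> holds ?c \<tau>" for \<tau>
  proof -
    \<comment> \<open>The queue is exhausted, so the expansion property holds for every entry and
      \<open>queue_inv_closed\<close> applies.\<close>
    have "regs \<tau> 15 = regs \<tau> 16" using that by (auto simp: search_inv_def)
    then have "arrays \<tau> 15 y \<noteq> 0 \<longleftrightarrow> (0, y) \<in> G\<^sup>*" for y
      using that(1) by (intro queue_inv_closed) (auto simp: search_inv_def)
    then show ?thesis using that by (auto simp: search_inv_def agree_def \<sigma>'_def)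
  qed
  have "wp search Q \<sigma>" if "wp (While ?c
      (Assign 17 (Cell 12 (Cell 16 (Reg 15))) ;; While (Less (Const 0) (Reg 17)) visit_edge ;;
       Assign 15 (Plus (Reg 15) (Const 1)))) (\<lambda>t. Q (10 + t)) \<sigma>'" for Q
  proof -
    have "10 + t = Suc (Suc (Suc (Suc (Suc (Suc (Suc (Suc (Suc (Suc t)))))))))" for t :: nat by simp
    with that show ?thesis by (simp add: search_def wp_simps \<sigma>'_def z)
  qed
  then show ?thesis
    by this (rule wp_mono[OF loop], use fin pot in auto)
qed

end

lemma wp_search:
  assumes "represents \<sigma> G" "G \<subseteq> {..N} \<times> {..N}" "arrays \<sigma> 15 = (\<lambda>_. 0)"
  shows "wp search (\<lambda>t \<tau>. agree {14, 15, 16, 17} {15, 16} \<sigma> \<tau> \<and>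
    (\<forall>y. arrays \<tau> 15 y \<noteq> 0 \<longleftrightarrow> (0, y) \<in> G\<^sup>*) \<and> t \<le> 30 * Suc N + 30 * regs \<sigma> 12 + 20) \<sigma>"
  using assms wp_search_adjacency unfolding represents_def by blast


section \<open>The program\<close>

text \<open>
  Array 10 maps the state \<open>us ! i\<close> to \<open>i * n\<close> and \<open>vs ! j\<close> to \<open>j\<close>, so that the node of a pair of states
  is a sum and no multiplication is needed. Array 11 saves \<open>us\<close>, since the output overwrites array 0.
  Arrays 12, 13 and 14 hold the adjacency lists (first edge of a node, target of an edge, next edge),
  and register 12 the number of the next edge. Arrays 15 and 16 hold the marks and the queue of the
  search, registers 15 and 16 the two ends of the queue.
\<close>

definition number_states :: prog where
  "number_states =
     For 9 4 (Store 10 (Cell 5 (Reg 9)) (Reg 9)) ;;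
     Assign 11 (Const 0) ;;
     For 9 0
       (Store 10 (Cell 0 (Reg 9)) (Reg 11) ;; Store 11 (Reg 9) (Cell 0 (Reg 9)) ;;
        Assign 11 (Plus (Reg 11) (Reg 4)))"

definition add_cell_implications :: prog where
  "add_cell_implications =
     Assign 13 (Plus (Cell 10 (Cell 0 (Reg 9))) (Reg 10)) ;;
     Assign 14 (Minus (Reg 13) (Reg 4)) ;;
     add_edge 13 14 ;;
     Assign 14 (Plus (Reg 13) (Const 1)) ;;
     If (Less (Plus (Reg 10) (Const 1)) (Reg 4)) (add_edge 13 14) Skip"

definition load_nodes :: prog where
  "load_nodes =
     Assign 13 (Plus (Cell 10 (Cell 1 (Reg 9))) (Cell 10 (Cell 6 (Reg 10)))) ;;
     Assign 14 (Plus (Cell 10 (Cell 2 (Reg 9))) (Cell 10 (Cell 7 (Reg 10)))) ;;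
     If (Equal (Reg 13) (Const 0)) (Assign 13 (Reg 14)) Skip ;;
     If (Less (Cell 3 (Reg 9)) (Cell 8 (Reg 10))) (Assign 13 (Const 0)) Skip ;;
     If (Less (Cell 8 (Reg 10)) (Cell 3 (Reg 9))) (Assign 13 (Reg 4)) Skip"

definition add_edge_implications :: prog where
  "add_edge_implications = load_nodes ;; add_edge 13 14 ;; add_edge 14 13"

definition output_first :: prog where
  "output_first =
     Store 0 (Minus (Plus (Reg 9) (Reg 10)) (Const 1)) (Cell 11 (Reg 9)) ;;
     Assign 9 (Plus (Reg 9) (Const 1)) ;; Assign 11 (Plus (Reg 11) (Reg 4))"

definition output_second :: prog where
  "output_second =
     Store 0 (Minus (Plus (Reg 9) (Reg 10)) (Const 1)) (Cell 5 (Reg 10)) ;;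
     Assign 10 (Plus (Reg 10) (Const 1))"

definition start_merge :: prog where
  "start_merge =
     Store 0 (Const 0) (Reg 8) ;; Assign 9 (Const 1) ;; Assign 10 (Const 1) ;; Assign 11 (Reg 4)"

definition merge_states :: prog where
  "merge_states =
     start_merge ;;
     While (Less (Plus (Reg 9) (Reg 10)) (Plus (Reg 0) (Reg 4)))
       (If (Less (Reg 10) (Reg 4))
         (If (Equal (Cell 15 (Plus (Reg 11) (Reg 10))) (Const 0)) output_second output_first)
         output_first) ;;
     Assign 1 (Minus (Plus (Reg 0) (Reg 4)) (Const 1)) ;; Assign 0 (Const 1)"

definition C_order_program :: prog where
  "C_order_program =
     number_states ;;
     Assign 12 (Const 1) ;;
     For 9 0 (For 10 4 add_cell_implications) ;;
     For 9 1 (For 10 5 add_edge_implications) ;;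
     search ;;
     If (Equal (Cell 15 (Reg 4)) (Const 0)) merge_states (Assign 0 (Const 0))"

text \<open>The common frame of the two phases that build the graph. Besides the graph it tracks
  register 12, since the number of stored edges enters the time of the search. The 14 is the 6 of
  the inner loop plus the 8 of an outer iteration.\<close>

lemma wp_For_For:
  assumes y: "regs \<sigma> y = M" "regs \<sigma> y' = L" "y \<notin> {9..14}" "y' \<notin> {9..14}" and G: "represents \<sigma> G"
    and body: "\<And>i j H \<tau>. i < M \<Longrightarrow> j < L \<Longrightarrow> agree {9..14} {12..14} \<sigma> \<tau> \<Longrightarrow>
      regs \<tau> 9 = i \<Longrightarrow> regs \<tau> 10 = j \<Longrightarrow> represents \<tau> H \<Longrightarrow>
      wp p (\<lambda>t \<rho>. t \<le> c \<and> agree {12..14} {12..14} \<tau> \<rho> \<and> represents \<rho> (H \<union> B i j) \<and>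
        regs \<rho> 12 \<le> regs \<tau> 12 + 2) \<tau>"
  shows "wp (For 9 y (For 10 y' p)) (\<lambda>t \<tau>. agree {9..14} {12..14} \<sigma> \<tau> \<and>
     represents \<tau> (G \<union> (\<Union>i<M. \<Union>j<L. B i j)) \<and> regs \<tau> 12 \<le> regs \<sigma> 12 + 2 * (M * L) \<and>
     t \<le> M * (L * (c + 8) + 14) + 6) \<sigma>"
proof -
  define I where "I = (\<lambda>i \<tau>. agree {9..14} {12..14} \<sigma> \<tau> \<and> regs \<tau> 9 = i \<and>
    represents \<tau> (G \<union> (\<Union>i<i. \<Union>j<L. B i j)) \<and> regs \<tau> 12 \<le> regs \<sigma> 12 + 2 * (i * L))"
  define J where "J = (\<lambda>i j \<tau>. agree {9..14} {12..14} \<sigma> \<tau> \<and> regs \<tau> 9 = i \<and> regs \<tau> 10 = j \<and>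
    represents \<tau> (G \<union> (\<Union>i<i. \<Union>j<L. B i j) \<union> (\<Union>j<j. B i j)) \<and>
    regs \<tau> 12 \<le> regs \<sigma> 12 + 2 * (i * L) + 2 * j)"
  have ry: "regs \<tau> y = M" "regs \<tau> y' = L" if "agree {9..14} {12..14} \<sigma> \<tau>" for \<tau>
    using that y by (auto simp: agree_def)
  have "wp (For 9 y (For 10 y' p)) (\<lambda>t \<tau>. I M \<tau> \<and> t \<le> M * ((L * (c + 8) + 6) + 8) + 6) \<sigma>"
  proof (rule wp_For)
    show "I 0 (\<sigma>\<lparr>regs := (regs \<sigma>)(9 := 0)\<rparr>)"
      using G by (simp add: I_def represents_regs agree_regs agree_refl)
  next
    fix i \<tau> assume "I i \<tau>"
    then show "regs \<tau> 9 = i \<and> regs \<tau> y = M" using ry by (simp add: I_def)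
  next
    fix i \<tau> assume i: "i < M" and I: "I i \<tau>"
    have "wp (For 10 y' p) (\<lambda>t \<tau>. J i L \<tau> \<and> t \<le> L * (c + 8) + 6) \<tau>"
    proof (rule wp_For)
      show "J i 0 (\<tau>\<lparr>regs := (regs \<tau>)(10 := 0)\<rparr>)"
        using I by (simp add: I_def J_def represents_regs agree_regs)
    next
      fix j \<tau> assume "J i j \<tau>"
      then show "regs \<tau> 10 = j \<and> regs \<tau> y' = L" using ry by (simp add: J_def)
    next
      fix j \<tau> assume j: "j < L" and J: "J i j \<tau>"
      let ?H = "G \<union> (\<Union>i<i. \<Union>j<L. B i j) \<union> (\<Union>j<j. B i j)"
      have H: "?H \<union> B i j = G \<union> (\<Union>i<i. \<Union>j<L. B i j) \<union> (\<Union>j<Suc j. B i j)"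
        by (auto simp: lessThan_Suc)
      show "wp p (\<lambda>t \<rho>. t \<le> c \<and> regs \<rho> 10 = j \<and> J i (Suc j) (\<rho>\<lparr>regs := (regs \<rho>)(10 := Suc j)\<rparr>)) \<tau>"
      proof (rule wp_mono[OF body[OF i j, where H = ?H and \<tau> = \<tau>]], goal_cases)
        case (5 t \<rho>)
        then have "agree {9..14} {12..14} \<sigma> \<rho>" using J agree_trans[of "{9..14}" "{12..14}" \<sigma> \<tau> "{12..14}" "{12..14}" \<rho>] by (simp add: J_def)
        moreover have "regs \<rho> 9 = i" "regs \<rho> 10 = j" using 5 J by (auto simp: J_def agree_def)
        ultimately show ?case
          using 5 J unfolding J_def H by (simp add: represents_regs agree_regs)
      qed (use J in \<open>simp_all add: J_def\<close>)
    qed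
    then show "wp (For 10 y' p) (\<lambda>t \<rho>. t \<le> L * (c + 8) + 6 \<and> regs \<rho> 9 = i \<and>
        I (Suc i) (\<rho>\<lparr>regs := (regs \<rho>)(9 := Suc i)\<rparr>)) \<tau>"
    proof (rule wp_mono, elim conjE)
      fix t \<rho> assume J: "J i L \<rho>" and t: "t \<le> L * (c + 8) + 6"
      have "G \<union> (\<Union>i<i. \<Union>j<L. B i j) \<union> (\<Union>j<L. B i j) = G \<union> (\<Union>i<Suc i. \<Union>j<L. B i j)"
        by (auto simp: lessThan_Suc)
      then show "t \<le> L * (c + 8) + 6 \<and> regs \<rho> 9 = i \<and> I (Suc i) (\<rho>\<lparr>regs := (regs \<rho>)(9 := Suc i)\<rparr>)"
        using J t by (simp add: I_def J_def represents_regs agree_regs)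
    qed
  qed
  then show ?thesis by (rule wp_mono) (simp add: I_def add.commute)
qed

text \<open>Here \<open>es\<close> and \<open>fs\<close> are the edge lists of the two automata;
  \<open>fs\<close> does not list final states.\<close>

locale wheeler_input = wheeler_pair us vs E F s pos
  for us vs :: "nat list" and E F :: "(nat \<times> nat \<times> nat) set" and s pos +
  fixes es fs :: "(nat \<times> nat \<times> nat) list"
  assumes es: "distinct es" "set es = E" and fs: "distinct fs" "set fs = F"
begin

text \<open>The input layout: registers 0 to 3 and arrays 0 to 4 belong to the first automaton,
  registers 4 to 7 and arrays 5 to 9 to the second, and register 8 holds the new start
  state.\<close>

definition loaded :: "config \<Rightarrow> bool" where
  "loaded \<sigma> \<longleftrightarrow> regs \<sigma> 0 = m \<and> regs \<sigma> 1 = length es \<and> regs \<sigma> 4 = n \<and> regs \<sigma> 5 = length fs \<and> regs \<sigma> 8 = s \<and>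
     (\<forall>i<m. arrays \<sigma> 0 i = us ! i) \<and> (\<forall>j<n. arrays \<sigma> 5 j = vs ! j) \<and>
     (\<forall>i<length es. (arrays \<sigma> 1 i, arrays \<sigma> 2 i, arrays \<sigma> 3 i) = es ! i) \<and>
     (\<forall>j<length fs. (arrays \<sigma> 6 j, arrays \<sigma> 7 j, arrays \<sigma> 8 j) = fs ! j)"

lemma loaded_agree:
  "loaded \<sigma> \<Longrightarrow> agree {9..17} {10..16} \<sigma> \<tau> \<Longrightarrow> loaded \<tau>"
  by (simp add: loaded_def agree_def)

definition numbered :: "config \<Rightarrow> bool" where
  "numbered \<sigma> \<longleftrightarrow> (\<forall>i<m. arrays \<sigma> 10 (us ! i) = i * n) \<and> (\<forall>j<n. arrays \<sigma> 10 (vs ! j) = j) \<and>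
     (\<forall>i<m. arrays \<sigma> 11 i = us ! i)"

lemma wp_number_states:
  assumes "loaded \<sigma>"
  shows "wp number_states (\<lambda>t \<tau>. agree {9, 11} {10, 11} \<sigma> \<tau> \<and> numbered \<tau> \<and> t \<le> 40 * (m + n) + 40) \<sigma>"
proof -
  define I where "I = (\<lambda>k \<tau>. agree {9} {10} \<sigma> \<tau> \<and> regs \<tau> 9 = k \<and> (\<forall>j<k. arrays \<tau> 10 (vs ! j) = j))"
  define J where "J = (\<lambda>k \<tau>. agree {9, 11} {10, 11} \<sigma> \<tau> \<and> regs \<tau> 9 = k \<and> regs \<tau> 11 = k * n \<and>
    (\<forall>j<n. arrays \<tau> 10 (vs ! j) = j) \<and> (\<forall>i<k. arrays \<tau> 10 (us ! i) = i * n \<and> arrays \<tau> 11 i = us ! i))"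
  have 1: "wp (For 9 4 (Store 10 (Cell 5 (Reg 9)) (Reg 9))) (\<lambda>t \<tau>. I n \<tau> \<and> t \<le> n * (4 + 8) + 6) \<sigma>"
  proof (rule wp_For)
    show "I 0 (\<sigma>\<lparr>regs := (regs \<sigma>)(9 := 0)\<rparr>)" by (simp add: I_def agree_def)
  next
    fix k \<tau> assume "I k \<tau>"
    then show "regs \<tau> 9 = k \<and> regs \<tau> 4 = n" using assms by (simp add: I_def agree_def loaded_def)
  next
    fix k \<tau> assume k: "k < n" "I k \<tau>"
    then have "arrays \<tau> 5 k = vs ! k" using assms by (simp add: I_def agree_def loaded_def)
    then show "wp (Store 10 (Cell 5 (Reg 9)) (Reg 9))
        (\<lambda>t \<rho>. t \<le> 4 \<and> regs \<rho> 9 = k \<and> I (Suc k) (\<rho>\<lparr>regs := (regs \<rho>)(9 := Suc k)\<rparr>)) \<tau>"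
      using k by (auto simp: wp_Store I_def agree_def less_Suc_eq nth_simps)
  qed
  \<comment> \<open>Register 11 runs through the multiples of \<open>n\<close> by repeated addition.
    The numbers of the second automaton survive in array 10 because the names are disjoint.\<close>
  have 2: "wp (For 9 0 (Store 10 (Cell 0 (Reg 9)) (Reg 11) ;; Store 11 (Reg 9) (Cell 0 (Reg 9)) ;;
      Assign 11 (Plus (Reg 11) (Reg 4)))) (\<lambda>t \<tau>. J m \<tau> \<and> t \<le> m * (12 + 8) + 6) \<tau>'"
    if \<tau>': "I n \<tau>" "\<tau>' = \<tau>\<lparr>regs := (regs \<tau>)(11 := 0)\<rparr>" for \<tau> \<tau>'
  proof (rule wp_For)
    show "J 0 (\<tau>'\<lparr>regs := (regs \<tau>')(9 := 0)\<rparr>)" using \<tau>' by (simp add: I_def J_def agree_def)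
  next
    fix k \<tau> assume "J k \<tau>"
    then show "regs \<tau> 9 = k \<and> regs \<tau> 0 = m" using assms by (simp add: J_def agree_def loaded_def)
  next
    fix k \<tau> assume k: "k < m" "J k \<tau>"
    then have "arrays \<tau> 0 k = us ! k" "regs \<tau> 4 = n" using assms by (simp_all add: J_def agree_def loaded_def)
    then show "wp (Store 10 (Cell 0 (Reg 9)) (Reg 11) ;; Store 11 (Reg 9) (Cell 0 (Reg 9)) ;;
        Assign 11 (Plus (Reg 11) (Reg 4)))
        (\<lambda>t \<rho>. t \<le> 12 \<and> regs \<rho> 9 = k \<and> J (Suc k) (\<rho>\<lparr>regs := (regs \<rho>)(9 := Suc k)\<rparr>)) \<tau>"
      using k by (auto simp: wp_simps J_def agree_def less_Suc_eq nth_simps)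
  qed
  show ?thesis
    unfolding number_states_def wp_Seq wp_Assign eval.simps
  proof (rule wp_mono[OF 1], elim conjE, rule wp_mono[OF 2], assumption, rule refl, elim conjE)
    fix t \<tau> t' \<tau>' assume "t \<le> n * (4 + 8) + 6" "J m \<tau>'" "t' \<le> m * (12 + 8) + 6"
    then show "agree {9, 11} {10, 11} \<sigma> \<tau>' \<and> numbered \<tau>' \<and>
        t + (1 + exp_cost (Const 0) + t') \<le> 40 * (m + n) + 40"
      by (simp add: J_def numbered_def)
  qed
qed

lemma wp_add_cell_implications:
  assumes l: "loaded \<tau>" "numbered \<tau>" and ij: "i < m" "j < n" "regs \<tau> 9 = i" "regs \<tau> 10 = j"
    and H: "represents \<tau> H"
  shows "wp add_cell_implications (\<lambda>t \<rho>. t \<le> 60 \<and> agree {12..14} {12..14} \<tau> \<rho> \<and>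
    represents \<rho> (H \<union> ({(i * n + j, i * n + j - n)} \<union>
      (if Suc j < n then {(i * n + j, Suc (i * n + j))} else {}))) \<and>
    regs \<rho> 12 \<le> regs \<tau> 12 + 2) \<tau>"
proof -
  have x: "arrays \<tau> 10 (arrays \<tau> 0 i) = i * n" "regs \<tau> 4 = n"
    using l ij by (auto simp: loaded_def numbered_def)
  have insert_commute': "H \<union> ({e} \<union> A) = A \<union> insert e H" for e :: "nat \<times> nat" and A by auto
  show ?thesis
    unfolding add_cell_implications_def wp_Seq wp_Assign
  proof (rule wp_add_edge[where G = H], goal_cases)
    case 1
    then show ?case using H by (simp add: represents_def)
  next
    case (2 \<rho>)
    then have \<rho>: "represents \<rho> (insert (i * n + j, i * n + j - n) H)" "regs \<rho> 13 = i * n + j"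
      "regs \<rho> 12 = Suc (regs \<tau> 12)" "regs \<rho> 10 = j" "regs \<rho> 4 = n" "agree {12..14} {12..14} \<tau> \<rho>"
      using x ij by (auto simp: agree_def)
    show ?case
    proof (cases "Suc j < n")
      case True
      have "wp (add_edge 13 14) (\<lambda>t' \<rho>'. t' \<le> 14 \<and> agree {12..14} {12..14} \<tau> \<rho>' \<and>
          represents \<rho>' (insert (i * n + j, Suc (i * n + j)) (insert (i * n + j, i * n + j - n) H)) \<and>
          regs \<rho>' 12 \<le> regs \<tau> 12 + 2) (\<rho>\<lparr>regs := (regs \<rho>)(14 := Suc (i * n + j))\<rparr>)"
        by (rule wp_add_edge[where G = "insert (i * n + j, i * n + j - n) H"])
          (use \<rho> in \<open>auto simp: represents_def agree_def\<close>)
      then show ?thesis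
        unfolding wp_If insert_commute' using True \<rho> by (simp, elim wp_mono) (simp add: insert_commute)
    next
      case False
      then show ?thesis
        unfolding wp_If wp_Skip using \<rho> by (simp add: represents_def agree_def)
    qed
  qed
qed

text \<open>The test for two start states comes first and the label tests overwrite its outcome,
  which reproduces the precedence of the cases in \<open>source_node\<close>.\<close>

lemma wp_load_nodes:
  assumes l: "loaded \<tau>" "numbered \<tau>" and ij: "i < length es" "j < length fs" "regs \<tau> 9 = i" "regs \<tau> 10 = j"
  shows "wp load_nodes (\<lambda>t \<rho>. t \<le> 70 \<and> agree {13, 14} {} \<tau> \<rho> \<and>
    regs \<rho> 13 = source_node pos n (es ! i) (fs ! j) \<and> regs \<rho> 14 = target_node pos (es ! i) (fs ! j)) \<tau>"
proof -
  obtain u v c where e: "es ! i = (u, v, c)" by (metis surj_pair)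
  obtain u' v' d where f: "fs ! j = (u', v', d)" by (metis surj_pair)
  have eE: "(u, v, c) \<in> E" and fF: "(u', v', d) \<in> F"
    using e f ij es fs by (metis nth_mem)+
  have a: "arrays \<tau> 1 i = u" "arrays \<tau> 2 i = v" "arrays \<tau> 3 i = c"
    "arrays \<tau> 6 j = u'" "arrays \<tau> 7 j = v'" "arrays \<tau> 8 j = d" "regs \<tau> 4 = n"
    using l(1) ij e f by (auto simp: loaded_def)
  have p: "arrays \<tau> 10 u = pos u" "arrays \<tau> 10 v = pos v" "arrays \<tau> 10 u' = pos u'" "arrays \<tau> 10 v' = pos v'"
    using A.edge_nth[OF eE] B.edge_nth[OF fF] l(2) by (auto simp: numbered_def pos_us pos_vs)
  show ?thesis
    unfolding load_nodes_def wp_Seq wp_Assign e f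
    by (intro wp_If_Assign) (use ij(3,4) a p in \<open>simp add: agree_def source_node_def target_node_def\<close>)
qed

definition pair_implications :: "nat \<Rightarrow> nat \<Rightarrow> nat rel" where
  "pair_implications i j =
    {(source_node pos n (es ! i) (fs ! j), target_node pos (es ! i) (fs ! j)),
     (target_node pos (es ! i) (fs ! j), source_node pos n (es ! i) (fs ! j))}"

lemma edge_implications_UN:
  "edge_implications pos n E F = (\<Union>i<length es. \<Union>j<length fs. pair_implications i j)"
proof -
  have "E = (!) es ` {..<length es}" "F = (!) fs ` {..<length fs}"
    using es fs by (auto simp: set_conv_nth)
  then show ?thesis unfolding edge_implications_def pair_implications_def by simp
qed

lemma wp_add_edge_implications:
  assumes l: "loaded \<tau>" "numbered \<tau>" and ij: "i < length es" "j < length fs" "regs \<tau> 9 = i" "regs \<tau> 10 = j"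
    and H: "represents \<tau> H"
  shows "wp add_edge_implications (\<lambda>t \<rho>. t \<le> 100 \<and> agree {12..14} {12..14} \<tau> \<rho> \<and>
    represents \<rho> (H \<union> pair_implications i j) \<and> regs \<rho> 12 \<le> regs \<tau> 12 + 2) \<tau>"
  unfolding add_edge_implications_def wp_Seq
proof (rule wp_mono[OF wp_load_nodes[OF l ij]], elim conjE)
  let ?x = "source_node pos n (es ! i) (fs ! j)" and ?y = "target_node pos (es ! i) (fs ! j)"
  fix t :: nat and \<rho> assume t: "t \<le> 70" and a: "agree {13, 14} {} \<tau> \<rho>" and xy: "regs \<rho> 13 = ?x" "regs \<rho> 14 = ?y"
  have r: "represents \<rho> H" using H a by (simp add: represents_def agree_def)
  show "wp (add_edge 13 14) (\<lambda>t' \<tau>'. wp (add_edge 14 13) (\<lambda>t'' \<rho>. t + (t' + t'') \<le> 100 \<and>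
      agree {12..14} {12..14} \<tau> \<rho> \<and> represents \<rho> (H \<union> pair_implications i j) \<and>
      regs \<rho> 12 \<le> regs \<tau> 12 + 2) \<tau>') \<rho>"
  proof (rule wp_add_edge[OF r])
    fix \<tau>' assume r': "represents \<tau>' (insert (regs \<rho> 13, regs \<rho> 14) H)" and
      a': "agree {12} {12, 13, 14} \<rho> \<tau>'" and k': "regs \<tau>' 12 = Suc (regs \<rho> 12)"
    show "wp (add_edge 14 13) (\<lambda>t'' \<rho>. t + (14 + t'') \<le> 100 \<and>
      agree {12..14} {12..14} \<tau> \<rho> \<and> represents \<rho> (H \<union> pair_implications i j) \<and>
      regs \<rho> 12 \<le> regs \<tau> 12 + 2) \<tau>'"
    proof (rule wp_add_edge[OF r'])
      fix \<rho>' assume r'': "represents \<rho>' (insert (regs \<tau>' 14, regs \<tau>' 13) (insert (regs \<rho> 13, regs \<rho> 14) H))"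
        and a'': "agree {12} {12, 13, 14} \<tau>' \<rho>'" and k'': "regs \<rho>' 12 = Suc (regs \<tau>' 12)"
      have "insert (regs \<tau>' 14, regs \<tau>' 13) (insert (regs \<rho> 13, regs \<rho> 14) H) = H \<union> pair_implications i j"
        using a' xy by (auto simp: pair_implications_def agree_def)
      moreover have "agree {12..14} {12..14} \<tau> \<rho>'"
        using a a' a'' by (auto simp: agree_def)
      moreover have "regs \<rho> 12 = regs \<tau> 12" using a by (simp add: agree_def)
      ultimately show "t + (14 + 14) \<le> 100 \<and> agree {12..14} {12..14} \<tau> \<rho>' \<and>
          represents \<rho>' (H \<union> pair_implications i j) \<and> regs \<rho>' 12 \<le> regs \<tau> 12 + 2"
        using t r'' k' k'' by simp
    qed
  qed
qed

text \<open>The output so far has \<open>1 + (i - 1) + (j - 1)\<close> entries: \<open>s\<close> and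
  the states before the two candidates. Register 11 keeps the row offset.\<close>

definition merge_inv :: "config \<Rightarrow> config \<Rightarrow> bool" where
  "merge_inv \<sigma> \<tau> \<longleftrightarrow> agree {9, 10, 11} {0} \<sigma> \<tau> \<and> regs \<tau> 11 = regs \<tau> 9 * n \<and>
     merged (regs \<tau> 9) (regs \<tau> 10) (map (arrays \<tau> 0) [0..<regs \<tau> 9 + regs \<tau> 10 - 1])"

context
  fixes \<sigma>
  assumes loaded: "loaded \<sigma>" and numbered: "numbered \<sigma>"
    and searched: "\<And>y. arrays \<sigma> 15 y \<noteq> 0 \<longleftrightarrow> y \<in> reached"
begin

lemma merge_inv_state:
  assumes "merge_inv \<sigma> \<tau>"
  shows "regs \<tau> 0 = m" "regs \<tau> 4 = n" "\<And>i. i < m \<Longrightarrow> arrays \<tau> 11 i = us ! i"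
    "\<And>j. j < n \<Longrightarrow> arrays \<tau> 5 j = vs ! j" "arrays \<tau> 15 y = 0 \<longleftrightarrow> y \<notin> reached"
  using assms loaded numbered searched[of y] by (auto simp: merge_inv_def agree_def loaded_def numbered_def)

lemma wp_output_first:
  assumes I: "merge_inv \<sigma> \<tau>" and i: "regs \<tau> 9 < m"
    and r: "regs \<tau> 10 < n \<Longrightarrow> regs \<tau> 9 * n + regs \<tau> 10 \<in> reached"
  shows "wp output_first (\<lambda>t \<rho>. t \<le> 20 \<and> merge_inv \<sigma> \<rho> \<and>
    regs \<rho> 9 + regs \<rho> 10 = Suc (regs \<tau> 9 + regs \<tau> 10)) \<tau>"
proof -
  note st = merge_inv_state[OF I]
  define k where "k = regs \<tau> 9 + regs \<tau> 10 - 1"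
  have M: "merged (regs \<tau> 9) (regs \<tau> 10) (map (arrays \<tau> 0) [0..<k])"
    using I by (simp add: merge_inv_def k_def)
  then have k: "regs \<tau> 9 + regs \<tau> 10 = Suc k" by (simp add: merged_def k_def)
  have "map ((arrays \<tau> 0)(k := us ! regs \<tau> 9)) [0..<Suc k] = map (arrays \<tau> 0) [0..<k] @ [us ! regs \<tau> 9]"
    by simp
  then have "merged (Suc (regs \<tau> 9)) (regs \<tau> 10) (map ((arrays \<tau> 0)(k := us ! regs \<tau> 9)) [0..<Suc k])"
    using merged_first[OF M i r] by (simp only:)
  then show ?thesis
    unfolding output_first_def wp_simps using I i k st
    by (simp add: merge_inv_def agree_def del: upt_Suc)
qed

lemma wp_output_second:
  assumes I: "merge_inv \<sigma> \<tau>" and j: "regs \<tau> 10 < n"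
    and r: "regs \<tau> 9 * n + regs \<tau> 10 \<notin> reached"
  shows "wp output_second (\<lambda>t \<rho>. t \<le> 20 \<and> merge_inv \<sigma> \<rho> \<and>
    regs \<rho> 9 + regs \<rho> 10 = Suc (regs \<tau> 9 + regs \<tau> 10)) \<tau>"
proof -
  note st = merge_inv_state[OF I]
  define k where "k = regs \<tau> 9 + regs \<tau> 10 - 1"
  have M: "merged (regs \<tau> 9) (regs \<tau> 10) (map (arrays \<tau> 0) [0..<k])"
    using I by (simp add: merge_inv_def k_def)
  then have k: "regs \<tau> 9 + regs \<tau> 10 = Suc k" by (simp add: merged_def k_def)
  have "map ((arrays \<tau> 0)(k := vs ! regs \<tau> 10)) [0..<Suc k] = map (arrays \<tau> 0) [0..<k] @ [vs ! regs \<tau> 10]"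
    by simp
  then have "merged (regs \<tau> 9) (Suc (regs \<tau> 10)) (map ((arrays \<tau> 0)(k := vs ! regs \<tau> 10)) [0..<Suc k])"
    using merged_second[OF M j r] by (simp only:)
  then show ?thesis
    unfolding output_second_def wp_simps using I j k st
    by (simp add: merge_inv_def agree_def del: upt_Suc)
qed

text \<open>Because \<open>i \<le> m\<close> and \<open>j \<le> n\<close>, the single guard on the
  sum fails exactly when both lists are exhausted.\<close>

lemma wp_merge_loop:
  assumes "merge_inv \<sigma> \<tau>"
  shows "wp (While (Less (Plus (Reg 9) (Reg 10)) (Plus (Reg 0) (Reg 4)))
       (If (Less (Reg 10) (Reg 4))
         (If (Equal (Cell 15 (Plus (Reg 11) (Reg 10))) (Const 0)) output_second output_first)
         output_first))
    (\<lambda>t \<rho>. merge_inv \<sigma> \<rho> \<and> regs \<rho> 9 = m \<and> regs \<rho> 10 = n \<and> t \<le> 60 * (m + n) + 10) \<tau>"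
    (is "wp (While ?c ?p) _ _")
proof -
  define \<Phi> where "\<Phi> = (\<lambda>\<tau> :: config. 60 * (m + n - (regs \<tau> 9 + regs \<tau> 10)))"
  have "wp (While ?c ?p) (\<lambda>t \<rho>. merge_inv \<sigma> \<rho> \<and> \<not> holds ?c \<rho> \<and> t \<le> \<Phi> \<tau> + 1 + cond_cost ?c) \<tau>"
  proof (rule wp_While)
    show "merge_inv \<sigma> \<tau>" by fact
  next
    fix \<tau> assume I: "merge_inv \<sigma> \<tau>" and c: "holds ?c \<tau>"
    note st = merge_inv_state[OF I]
    let ?i = "regs \<tau> 9" and ?j = "regs \<tau> 10"
    have M: "merged ?i ?j (map (arrays \<tau> 0) [0..<?i + ?j - 1])" and r11: "regs \<tau> 11 = ?i * n"
      using I by (simp_all add: merge_inv_def)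
    have lt: "?i + ?j < m + n" using c st by simp
    have step: "wp q (\<lambda>t \<rho>. merge_inv \<sigma> \<rho> \<and> 1 + cond_cost ?c + (d + t) + \<Phi> \<rho> \<le> \<Phi> \<tau>) \<tau>"
      if "wp q (\<lambda>t \<rho>. t \<le> 20 \<and> merge_inv \<sigma> \<rho> \<and> regs \<rho> 9 + regs \<rho> 10 = Suc (?i + ?j)) \<tau>" "d \<le> 20" for q d
    proof (rule wp_mono[OF that(1)], elim conjE)
      fix t :: nat and \<rho> assume h: "t \<le> 20" "merge_inv \<sigma> \<rho>" "regs \<rho> 9 + regs \<rho> 10 = Suc (?i + ?j)"
      have "m + n - (?i + ?j) = Suc (m + n - Suc (?i + ?j))" using lt by simp
      then show "merge_inv \<sigma> \<rho> \<and> 1 + cond_cost ?c + (d + t) + \<Phi> \<rho> \<le> \<Phi> \<tau>"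
        using h that(2) by (simp add: \<Phi>_def)
    qed
    show "wp ?p (\<lambda>t \<rho>. merge_inv \<sigma> \<rho> \<and> 1 + cond_cost ?c + t + \<Phi> \<rho> \<le> \<Phi> \<tau>) \<tau>"
    proof (cases "?j < n")
      case j: True
      show ?thesis
      proof (cases "?i * n + ?j \<in> reached")
        case True
        \<comment> \<open>The program never tests whether the first list is exhausted: for
          \<open>i = m\<close> the inspected node exceeds \<open>m * n\<close>, as
          \<open>0 < j\<close>, and is therefore unmarked.\<close>
        have "?i < m"
        proof (rule ccontr)
          assume "\<not> ?i < m"
          then have "?i = m" using M by (simp add: merged_def)
          then show False using True reached_le[OF True] M by (simp add: merged_def)
        qed
        from step[OF wp_output_first[OF I this True] order.refl] show ?thesis
          unfolding wp_If using j True st r11 by simp (elim wp_mono, simp)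
      next
        case False
        from step[OF wp_output_second[OF I j False] order.refl] show ?thesis
          unfolding wp_If using j False st r11 by simp (elim wp_mono, simp)
      qed
    next
      case j: False
      then have "?i < m" using lt M by (simp add: merged_def)
      from step[OF wp_output_first[OF I this] order.refl] j show ?thesis
        unfolding wp_If using st by simp (elim wp_mono, simp)
    qed
  qed
  then show ?thesis
  proof (rule wp_mono, elim conjE)
    fix t \<rho> assume I: "merge_inv \<sigma> \<rho>" and c: "\<not> holds ?c \<rho>" and t: "t \<le> \<Phi> \<tau> + 1 + cond_cost ?c"
    have "regs \<rho> 9 \<le> m" "regs \<rho> 10 \<le> n" using I by (simp_all add: merge_inv_def merged_def)
    then show "merge_inv \<sigma> \<rho> \<and> regs \<rho> 9 = m \<and> regs \<rho> 10 = n \<and> t \<le> 60 * (m + n) + 10"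
      using I c t merge_inv_state(1,2)[OF I] by (simp add: \<Phi>_def)
  qed
qed

lemma wp_merge_states:
  "wp merge_states (\<lambda>t \<tau>. t \<le> 60 * (m + n) + 40 \<and> (\<exists>xs. result \<tau> = Some xs \<and>
    distinct xs \<and> set xs = union_states \<and> sorted_wrt before xs)) \<sigma>"
proof -
  define \<sigma>' where "\<sigma>' = \<sigma>\<lparr>arrays := (arrays \<sigma>)(0 := (arrays \<sigma> 0)(0 := s)),
    regs := (regs \<sigma>)(9 := 1, 10 := 1, 11 := n)\<rparr>"
  have "merge_inv \<sigma> \<sigma>'" using merged_start by (simp add: merge_inv_def agree_def \<sigma>'_def)
  note loop = wp_merge_loop[OF this]
  have \<sigma>: "regs \<sigma> 8 = s" "regs \<sigma> 4 = n" using loaded by (simp_all add: loaded_def)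
  have start: "wp start_merge (\<lambda>t \<tau>. t = 9 \<and> \<tau> = \<sigma>') \<sigma>"
    by (simp add: start_merge_def wp_simps \<sigma>'_def \<sigma>)
  show ?thesis
    unfolding merge_states_def
  proof (subst wp_Seq, rule wp_mono[OF start], elim conjE, simp only:, subst wp_Seq, rule wp_mono[OF loop], elim conjE)
    fix t' :: nat and \<tau> assume I: "merge_inv \<sigma> \<tau>" and mn: "regs \<tau> 9 = m" "regs \<tau> 10 = n"
      and t: "t' \<le> 60 * (m + n) + 10"
    have M: "merged m n (map (arrays \<tau> 0) [0..<m + n - 1])" using I mn by (simp add: merge_inv_def)
    then show "wp (Assign 1 (Minus (Plus (Reg 0) (Reg 4)) (Const 1)) ;; Assign 0 (Const 1))
        (\<lambda>t'' \<tau>. 9 + (t' + t'') \<le> 60 * (m + n) + 40 \<and> (\<exists>xs. result \<tau> = Some xs \<and>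
          distinct xs \<and> set xs = union_states \<and> sorted_wrt before xs)) \<tau>"
      using t merge_inv_state(1,2)[OF I] merged_end[OF M]
      by (simp add: wp_simps result_def) (simp add: merged_def)
  qed
qed

end


section \<open>Composition of the phases\<close>

lemma numbered_agree: "numbered \<sigma> \<Longrightarrow> agree {9..17} {12..16} \<sigma> \<tau> \<Longrightarrow> numbered \<tau>"
  by (simp add: numbered_def agree_def)

lemma prepared_agree:
  assumes "loaded \<sigma>" "numbered \<sigma>" "agree R A \<sigma> \<tau>" "R \<subseteq> {9..17}" "A \<subseteq> {12..16}"
  shows "loaded \<tau>" "numbered \<tau>"
proof -
  have "A \<subseteq> {10..16}" using assms(5) by (rule order_trans) auto
  then show "loaded \<tau>" using loaded_agree[OF assms(1)] agree_weaken[OF assms(3,4)] by blast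
  show "numbered \<tau>" using numbered_agree[OF assms(2)] agree_weaken[OF assms(3-5)] by blast
qed

lemma wp_C_order_program:
  assumes l: "loaded \<sigma>" and z: "arrays \<sigma> 12 = (\<lambda>_. 0)" "arrays \<sigma> 15 = (\<lambda>_. 0)"
  shows "wp C_order_program (\<lambda>t \<tau>.
    t \<le> 200 * (m * n + m + n + length es * length fs + length es + 2) \<and>
    (case result \<tau> of
       Some xs \<Rightarrow> distinct xs \<and> set xs = union_states \<and> C_order (list_order xs)
     | None \<Rightarrow> \<not> (\<exists>r. C_order r))) \<sigma>" (is "wp _ (\<lambda>t \<tau>. t \<le> ?T \<and> ?P \<tau>) \<sigma>")
proof -
  let ?cell = "\<lambda>i j. {(i * n + j, i * n + j - n)} \<union> (if Suc j < n then {(i * n + j, Suc (i * n + j))} else {})"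
  have cells: "wp (For 9 0 (For 10 4 add_cell_implications)) (\<lambda>t \<tau>. agree {9..14} {12..14} \<sigma> \<tau> \<and>
      represents \<tau> (cell_implications m n) \<and> regs \<tau> 12 \<le> 1 + 2 * (m * n) \<and> t \<le> m * (n * (60 + 8) + 14) + 6) \<sigma>"
    if l: "loaded \<sigma>" "numbered \<sigma>" and e: "represents \<sigma> {}" "regs \<sigma> 12 = 1" for \<sigma>
  proof -
    have "wp (For 9 0 (For 10 4 add_cell_implications)) (\<lambda>t \<tau>. agree {9..14} {12..14} \<sigma> \<tau> \<and>
      represents \<tau> ({} \<union> (\<Union>i<m. \<Union>j<n. ?cell i j)) \<and> regs \<tau> 12 \<le> regs \<sigma> 12 + 2 * (m * n) \<and>
      t \<le> m * (n * (60 + 8) + 14) + 6) \<sigma>"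
    proof (rule wp_For_For)
      fix i j H \<tau>
      assume h: "i < m" "j < n" "agree {9..14} {12..14} \<sigma> \<tau>" "regs \<tau> 9 = i" "regs \<tau> 10 = j" "represents \<tau> H"
      have "loaded \<tau>" "numbered \<tau>" by (rule prepared_agree[OF l h(3)]; auto)+
      from wp_add_cell_implications[OF this h(1,2,4,5,6)]
      show "wp add_cell_implications (\<lambda>t \<rho>. t \<le> 60 \<and> agree {12..14} {12..14} \<tau> \<rho> \<and>
          represents \<rho> (H \<union> ?cell i j) \<and> regs \<rho> 12 \<le> regs \<tau> 12 + 2) \<tau>" .
    qed (use l e in \<open>simp_all add: loaded_def\<close>)
    then show ?thesis unfolding cell_implications_UN e Un_empty_left .
  qed
  have pairs: "wp (For 9 1 (For 10 5 add_edge_implications)) (\<lambda>t \<tau>. agree {9..14} {12..14} \<sigma> \<tau> \<and>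
      represents \<tau> implications \<and> regs \<tau> 12 \<le> regs \<sigma> 12 + 2 * (length es * length fs) \<and>
      t \<le> length es * (length fs * (100 + 8) + 14) + 6) \<sigma>"
    if l: "loaded \<sigma>" "numbered \<sigma>" and e: "represents \<sigma> (cell_implications m n)" for \<sigma>
    unfolding implications_def edge_implications_UN
  proof (rule wp_For_For)
    fix i j H \<tau>
    assume h: "i < length es" "j < length fs" "agree {9..14} {12..14} \<sigma> \<tau>" "regs \<tau> 9 = i" "regs \<tau> 10 = j"
      "represents \<tau> H"
    have "loaded \<tau>" "numbered \<tau>" by (rule prepared_agree[OF l h(3)]; auto)+
    from wp_add_edge_implications[OF this h(1,2,4,5,6)]
    show "wp add_edge_implications (\<lambda>t \<rho>. t \<le> 100 \<and> agree {12..14} {12..14} \<tau> \<rho> \<and>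
        represents \<rho> (H \<union> pair_implications i j) \<and> regs \<rho> 12 \<le> regs \<tau> 12 + 2) \<tau>" .
  qed (use l e in \<open>simp_all add: loaded_def\<close>)
  have decide: "wp (If (Equal (Cell 15 (Reg 4)) (Const 0)) merge_states (Assign 0 (Const 0)))
      (\<lambda>t \<tau>. t \<le> 60 * (m + n) + 60 \<and> ?P \<tau>) \<sigma>"
    if l: "loaded \<sigma>" "numbered \<sigma>" and s: "\<And>y. arrays \<sigma> 15 y \<noteq> 0 \<longleftrightarrow> y \<in> reached" for \<sigma>
  proof (cases "n \<in> reached")
    case True
    then have "\<not> (\<exists>r. C_order r)" using C_order_imp_not_reached by blast
    then show ?thesis using True s[of n] l(1) by (simp add: wp_simps loaded_def result_def)
  next
    case False
    \<comment> \<open>Register 4 holds \<open>n\<close>, which is also the number of the false node,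
      so the tested mark decides solvability.\<close>
    then have "holds (Equal (Cell 15 (Reg 4)) (Const 0)) \<sigma>" using s[of n] l(1) by (simp add: loaded_def)
    moreover have "wp merge_states (\<lambda>t \<tau>. 1 + cond_cost (Equal (Cell 15 (Reg 4)) (Const 0)) + t \<le> 60 * (m + n) + 60 \<and>
        ?P \<tau>) \<sigma>"
      using before_C_order False by (intro wp_mono[OF wp_merge_states[OF l s]]) auto
    ultimately show ?thesis unfolding wp_If by simp
  qed
  show ?thesis
    unfolding C_order_program_def
  proof (subst wp_Seq, rule wp_mono[OF wp_number_states[OF l]], elim conjE, subst wp_Seq, subst wp_Assign)
    fix t1 :: nat and \<tau>1 assume a1: "agree {9, 11} {10, 11} \<sigma> \<tau>1" and n1: "numbered \<tau>1" and t1: "t1 \<le> 40 * (m + n) + 40"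
    define \<tau> where "\<tau> = \<tau>1\<lparr>regs := (regs \<tau>1)(12 := eval (Const 1) \<tau>1)\<rparr>"
    have a: "agree {9..17} {10..11} \<sigma> \<tau>" using a1 by (auto simp: agree_def \<tau>_def)
    have L: "loaded \<tau>" using loaded_agree[OF l] agree_weaken[OF a, of "{9..17}" "{10..16}"] by simp
    have N: "numbered \<tau>" using n1 by (simp add: numbered_def \<tau>_def)
    have z\<tau>: "arrays \<tau> 12 = (\<lambda>_. 0)" "arrays \<tau> 15 = (\<lambda>_. 0)" using z a by (simp_all add: agree_def)
    have e1: "regs \<tau> 12 = 1" by (simp add: \<tau>_def)
    have e: "represents \<tau> {}" using represents_empty e1 z\<tau> by blast
    show "wp (For 9 0 (For 10 4 add_cell_implications) ;; For 9 1 (For 10 5 add_edge_implications) ;; search ;;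
        If (Equal (Cell 15 (Reg 4)) (Const 0)) merge_states (Assign 0 (Const 0)))
        (\<lambda>t' \<tau>. t1 + (1 + exp_cost (Const 1) + t') \<le> ?T \<and> ?P \<tau>) (\<tau>1\<lparr>regs := (regs \<tau>1)(12 := eval (Const 1) \<tau>1)\<rparr>)"
      unfolding \<tau>_def[symmetric]
    proof (subst wp_Seq, rule wp_mono[OF cells[OF L N e e1]], elim conjE)
      fix t2 :: nat and \<tau>2
      assume a2: "agree {9..14} {12..14} \<tau> \<tau>2" and r2: "represents \<tau>2 (cell_implications m n)"
        and k2: "regs \<tau>2 12 \<le> 1 + 2 * (m * n)" and t2: "t2 \<le> m * (n * (60 + 8) + 14) + 6"
      have L2: "loaded \<tau>2" "numbered \<tau>2" by (rule prepared_agree[OF L N a2]; auto)+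
      show "wp (For 9 1 (For 10 5 add_edge_implications) ;; search ;;
          If (Equal (Cell 15 (Reg 4)) (Const 0)) merge_states (Assign 0 (Const 0)))
          (\<lambda>t' \<tau>. t1 + (1 + exp_cost (Const 1) + (t2 + t')) \<le> ?T \<and> ?P \<tau>) \<tau>2"
      proof (subst wp_Seq, rule wp_mono[OF pairs[OF L2 r2]], elim conjE)
        fix t3 :: nat and \<tau>3
        assume a3: "agree {9..14} {12..14} \<tau>2 \<tau>3" and r3: "represents \<tau>3 implications"
          and k3: "regs \<tau>3 12 \<le> regs \<tau>2 12 + 2 * (length es * length fs)"
          and t3: "t3 \<le> length es * (length fs * (100 + 8) + 14) + 6"
        have L3: "loaded \<tau>3" "numbered \<tau>3" by (rule prepared_agree[OF L2 a3]; auto)+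
        have z3: "arrays \<tau>3 15 = (\<lambda>_. 0)" using z\<tau> a2 a3 by (simp add: agree_def)
        show "wp (search ;; If (Equal (Cell 15 (Reg 4)) (Const 0)) merge_states (Assign 0 (Const 0)))
            (\<lambda>t' \<tau>. t1 + (1 + exp_cost (Const 1) + (t2 + (t3 + t'))) \<le> ?T \<and> ?P \<tau>) \<tau>3"
        proof (subst wp_Seq, rule wp_mono[OF wp_search[OF r3 implications_bounded z3]], elim conjE)
          fix t4 :: nat and \<tau>4
          assume a4: "agree {14, 15, 16, 17} {15, 16} \<tau>3 \<tau>4"
            and r4: "\<forall>y. arrays \<tau>4 15 y \<noteq> 0 \<longleftrightarrow> (0, y) \<in> implications\<^sup>*"
            and t4: "t4 \<le> 30 * Suc (m * n) + 30 * regs \<tau>3 12 + 20"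
          have L4: "loaded \<tau>4" "numbered \<tau>4" by (rule prepared_agree[OF L3 a4]; auto)+
          have s4: "arrays \<tau>4 15 y \<noteq> 0 \<longleftrightarrow> y \<in> reached" for y using r4 by (simp add: reached_def)
          \<comment> \<open>The largest coefficient in the sum of the bounds is 168, that of
            \<open>length es * length fs\<close>; the constants add up to less than
            \<open>2 * 200\<close>.\<close>
          have "t1 + (1 + exp_cost (Const 1) + (t2 + (t3 + (t4 + t5)))) \<le> ?T"
            if t5: "t5 \<le> 60 * (m + n) + 60" for t5
          proof -
            have "t2 \<le> 68 * (m * n) + 14 * m + 6" using t2 by (simp add: algebra_simps)
            moreover have "t3 \<le> 108 * (length es * length fs) + 14 * length es + 6"
              using t3 by (simp add: algebra_simps)
            moreover have "t4 \<le> 30 + 30 * (m * n) + 30 * (1 + 2 * (m * n) + 2 * (length es * length fs)) + 20"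
              using t4 k2 k3 by simp
            ultimately show ?thesis using t1 t5 by simp
          qed
          then show "wp (If (Equal (Cell 15 (Reg 4)) (Const 0)) merge_states (Assign 0 (Const 0)))
              (\<lambda>t' \<tau>. t1 + (1 + exp_cost (Const 1) + (t2 + (t3 + (t4 + t')))) \<le> ?T \<and> ?P \<tau>) \<tau>4"
            by (intro wp_mono[OF decide[OF L4 s4]]) blast
        qed
      qed
    qed
  qed
qed

end

lemma loaded_initial:
  assumes "wheeler_input us vs E F s pos es fs"
  shows "wheeler_input.loaded us vs s es fs
    (initial (reg_input us es gs s0 @ reg_input vs fs hs s1 @ [s]) (array_input us es gs @ array_input vs fs hs))"
  by (simp add: wheeler_input.loaded_def[OF assms] initial_def reg_input_def array_input_def contents_def)

theorem theorem4:
  "\<exists>(p :: prog) (C :: nat). \<forall>(A0 :: (nat, nat) nfa) (A1 :: (nat, nat) nfa) (s :: nat)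
     vs0 es0 fs0 vs1 es1 fs1.
     listing A0 vs0 es0 fs0 \<longrightarrow> listing A1 vs1 es1 fs1 \<longrightarrow>
     wheeler_automaton A0 (list_order vs0) \<longrightarrow> wheeler_automaton A1 (list_order vs1) \<longrightarrow>
     alphabet A0 = alphabet A1 \<longrightarrow>
     states A0 \<inter> states A1 = {} \<longrightarrow> s \<notin> states A0 \<union> states A1 \<longrightarrow>
     (\<exists>t \<tau>. run p
         (initial
           (reg_input vs0 es0 fs0 (start A0) @ reg_input vs1 es1 fs1 (start A1) @ [s])
           (array_input vs0 es0 fs0 @ array_input vs1 es1 fs1)) t \<tau> \<and>
       t \<le> C * (max 1 (card (edges A0)) * max 1 (card (edges A1))) \<and>
       (case result \<tau> of
          Some xs \<Rightarrow> distinct xs \<and> set xs = states (union_nfa s A0 A1) \<and>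
            wheeler_C_order s A0 (list_order vs0) A1 (list_order vs1) (list_order xs)
        | None \<Rightarrow> \<not> (\<exists>r. wheeler_C_order s A0 (list_order vs0) A1 (list_order vs1) r)))"
proof (rule exI[of _ C_order_program], rule exI[of _ 2400], intro allI impI)
  fix A0 A1 :: "(nat, nat) nfa" and s :: nat and vs0 es0 fs0 vs1 es1 fs1
  assume li: "listing A0 vs0 es0 fs0" "listing A1 vs1 es1 fs1"
    and w: "wheeler_automaton A0 (list_order vs0)" "wheeler_automaton A1 (list_order vs1)"
    and disj: "states A0 \<inter> states A1 = {}" and s: "s \<notin> states A0 \<union> states A1"
  let ?\<sigma> = "initial
           (reg_input vs0 es0 fs0 (start A0) @ reg_input vs1 es1 fs1 (start A1) @ [s])
           (array_input vs0 es0 fs0 @ array_input vs1 es1 fs1)"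
  have V: "set vs0 = states A0" "set vs1 = states A1" "distinct vs0" "distinct vs1"
    and E: "set es0 = edges A0" "set es1 = edges A1" "distinct es0" "distinct es1"
    using li by (simp_all add: listing_def)
  obtain pos where pos: "\<And>i. i < length vs0 \<Longrightarrow> pos (vs0 ! i) = i * length vs1"
    "\<And>j. j < length vs1 \<Longrightarrow> pos (vs1 ! j) = j"
    using wheeler_pair_exists_pos[of vs0 vs1] V disj by metis
  interpret A: indexed_wheeler vs0 "edges A0" by (rule indexed_wheeler_edges[OF w(1) li(1)])
  interpret B: indexed_wheeler vs1 "edges A1" by (rule indexed_wheeler_edges[OF w(2) li(2)])
  interpret U: wheeler_input vs0 vs1 "edges A0" "edges A1" s pos es0 es1
    by unfold_locales (use V E disj s pos in auto)
  note st = wheeler_automaton_start(2)[OF w(1) li(1)] wheeler_automaton_start(2)[OF w(2) li(2)]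
  have states: "U.union_states = states (union_nfa s A0 A1)"
    by (simp add: U.union_states_def union_nfa_def st V)
  have C: "U.C_order r \<longleftrightarrow> wheeler_C_order s A0 (list_order vs0) A1 (list_order vs1) r" for r
    by (simp add: U.C_order_def wheeler_C_order_def states U.union_edges_def union_nfa_def st V)
  have "U.loaded ?\<sigma>" by (rule loaded_initial) unfold_locales
  moreover have "arrays ?\<sigma> 12 = (\<lambda>_. 0)" "arrays ?\<sigma> 15 = (\<lambda>_. 0)"
    by (simp_all add: initial_def array_input_def)
  ultimately obtain t \<tau> where run: "run C_order_program ?\<sigma> t \<tau>"
    and t: "t \<le> 200 * (length vs0 * length vs1 + length vs0 + length vs1 + length es0 * length es1 + length es0 + 2)"
    and res: "case result \<tau> of
       Some xs \<Rightarrow> distinct xs \<and> set xs = U.union_states \<and> U.C_order (list_order xs)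
     | None \<Rightarrow> \<not> (\<exists>r. U.C_order r)"
    using U.wp_C_order_program unfolding wp_def by blast
  \<comment> \<open>An automaton that consists of its start state alone has no edges; the maximum
    keeps the product positive and gives
    \<open>length vs0 \<le> card (edges A0) + 1 \<le> 2 * P\<close>.\<close>
  define P where "P = max 1 (card (edges A0))"
  define Q where "Q = max 1 (card (edges A1))"
  have es: "length es0 \<le> P" "length es1 \<le> Q" "length vs0 \<le> 2 * P" "length vs1 \<le> 2 * Q" "1 \<le> P" "1 \<le> Q"
    using E A.length_le B.length_le by (auto simp: P_def Q_def distinct_card[symmetric])
  define R where "R = P * Q"
  have "P \<le> R" "Q \<le> R" "1 \<le> R" using es by (simp_all add: R_def)
  moreover have "length vs0 * length vs1 \<le> (2 * P) * (2 * Q)" "length es0 * length es1 \<le> R"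
    using es unfolding R_def by (intro mult_le_mono; simp)+
  moreover have "(2 * P) * (2 * Q) = 4 * R" by (simp add: R_def)
  \<comment> \<open>2400 is 200 times 12, the six summands being at most 4, 2, 2, 1, 1 and 2 times
    \<open>R\<close>.\<close>
  ultimately have "t \<le> 2400 * R" using t es by simp
  then show "\<exists>t \<tau>. run C_order_program ?\<sigma> t \<tau> \<and>
       t \<le> 2400 * (max 1 (card (edges A0)) * max 1 (card (edges A1))) \<and>
       (case result \<tau> of
          Some xs \<Rightarrow> distinct xs \<and> set xs = states (union_nfa s A0 A1) \<and>
            wheeler_C_order s A0 (list_order vs0) A1 (list_order vs1) (list_order xs)
        | None \<Rightarrow> \<not> (\<exists>r. wheeler_C_order s A0 (list_order vs0) A1 (list_order vs1) r))"
    using run res unfolding R_def P_def Q_def states C by blast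
qed

end
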